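(* Let $d \ge 1$, let $A \in \mathbb{R}^{(d+2)\times(d+2)}$ be symmetric positive definite, let $c \in \mathbb{R}^{d+2}$, let $\sigma > 0$, and consider the linear bandit problem on the ellipsoid $\mathcal{X} = \{x \in \mathbb{R}^{d+2} : \|x - c\|_{A^{-1}} \le 1\}$ with Gaussian noise $z_t \sim \mathcal{N}(0,\sigma^2)$. Then for any algorithm, any $B > 0$, any $T \ge 1$ and any $\theta \in \mathcal{E}_A(B) := \{\theta \in \mathbb{R}^{d+2} : \|\theta\|_A = B\}$, there exists $\theta' \in \mathcal{E}_A(B)$ with $$\|\theta - \theta'\|_A^2 \le \min\Big(\frac{\sigma d B}{\sqrt{T}},\, 4B^2\Big)$$ such that the regret of the algorithm on the problem with parameter $\theta'$ satisfies $$R_T(\theta') \ge \min\Big(\frac{\sigma d \sqrt{T}}{16},\, \frac{BT}{4}\Big).$$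
   Context: For a symmetric positive definite matrix $M$, $\|u\|_M := \sqrt{u^\top M u}$. Linear bandit model: the action set $\mathcal{X}$ is known; at each time $t = 1,\dots,T$ the learner chooses $x_t \in \mathcal{X}$ as a (possibly randomized) function of past actions and rewards $y_1,\dots,y_{t-1}$, then observes $y_t = x_t^\top \theta + z_t$, where $\theta$ is an unknown parameter vector and the $z_t$ are independent noise variables. An algorithm is any such (possibly randomized) rule. The regret is $R_T(\theta) := \mathbb{E}\big[\sum_{t=1}^T (x^\star(\theta) - x_t)^\top \theta\big]$, where $x^\star(\theta) \in \arg\max_{x\in\mathcal{X}} x^\top\theta$; for the ellipsoid $\mathcal{X}=\{x:\|x-c\|_{A^{-1}}\le 1\}$ and $\theta\neq 0$, $x^\star(\theta) = c + A\theta/\|\theta\|_A$. *)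

theory Defs
  imports "HOL-Probability.Probability"
begin

definition mnorm :: "real^'n^'n \<Rightarrow> real^'n \<Rightarrow> real" where
  "mnorm M u = sqrt (u \<bullet> (M *v u))"

definition sym_pos_def :: "real^'n^'n \<Rightarrow> bool" where
  "sym_pos_def M \<longleftrightarrow> transpose M = M \<and> (\<forall>x. x \<noteq> 0 \<longrightarrow> x \<bullet> (M *v x) > 0)"

definition ellipsoid :: "real^'n^'n \<Rightarrow> real^'n \<Rightarrow> (real^'n) set" where
  "ellipsoid A c = {x. mnorm (matrix_inv A) (x - c) \<le> 1}"

definition hist_space :: "nat \<Rightarrow> (nat \<Rightarrow> (real^'n::finite) \<times> real) measure" where
  "hist_space t = PiM {..<t} (\<lambda>_. borel)"

definition is_algorithm ::
  "(real^'n) set \<Rightarrow> (nat \<Rightarrow> (nat \<Rightarrow> (real^'n::finite) \<times> real) \<Rightarrow> (real^'n) measure) \<Rightarrow> bool" where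
  "is_algorithm X pol \<longleftrightarrow>
     (\<forall>t. pol t \<in> measurable (hist_space t) (prob_algebra borel)) \<and>
     (\<forall>t. \<forall>h \<in> space (hist_space t). emeasure (pol t h) X = 1)"

definition reward_dist :: "real \<Rightarrow> real^'n \<Rightarrow> real^'n \<Rightarrow> real measure" where
  "reward_dist \<sigma> \<theta> x = density lborel (normal_density (x \<bullet> \<theta>) \<sigma>)"

fun traj :: "(nat \<Rightarrow> (nat \<Rightarrow> (real^'n::finite) \<times> real) \<Rightarrow> (real^'n) measure) \<Rightarrow> real \<Rightarrow> real^'n
     \<Rightarrow> nat \<Rightarrow> (nat \<Rightarrow> (real^'n::finite) \<times> real) measure" where
  "traj pol \<sigma> \<theta> 0 = return (hist_space 0) (\<lambda>_. undefined)"
| "traj pol \<sigma> \<theta> (Suc t) =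
     traj pol \<sigma> \<theta> t \<bind> (\<lambda>h. pol t h \<bind> (\<lambda>x.
       distr (reward_dist \<sigma> \<theta> x) (hist_space (Suc t)) (\<lambda>y. h(t := (x, y)))))"

definition regret ::
  "(real^'n) set \<Rightarrow> (nat \<Rightarrow> (nat \<Rightarrow> (real^'n::finite) \<times> real) \<Rightarrow> (real^'n) measure) \<Rightarrow> real \<Rightarrow> real^'n \<Rightarrow> nat \<Rightarrow> real" where
  "regret X pol \<sigma> \<theta> T =
     (\<integral>h. (\<Sum>t<T. (SUP x\<in>X. x \<bullet> \<theta>) - fst (h t) \<bullet> \<theta>) \<partial>traj pol \<sigma> \<theta> T)"

end

theory Submission
  imports Defs
begin

text \<open>The hard instances are the vertices of a hypercube
  \<open>w \<theta> \<plusminus> \<delta> e\<^sub>1 \<plusminus> \<dots> \<plusminus> \<delta> e\<^sub>d\<close> on the sphere \<open>\<parallel>\<cdot>\<parallel>\<^sub>A = B\<close>, where the \<open>e\<^sub>i\<close> are orthonormal and orthogonal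
  to \<open>\<theta>\<close> with respect to \<open>A\<close>, and orthogonal to the centre \<open>c\<close> in the usual sense; thus the offset \<open>c\<close>
  carries no information about the signs. By curvature of the ellipsoid, the regret of a round
  dominates a sum over \<open>i\<close> of squared errors \<open>(\<plusminus> \<delta> / B - x \<bullet> e\<^sub>i)\<^sup>2\<close>. For two vertices differing only in the
  sign of \<open>e\<^sub>i\<close>, these errors have a large sum over the two signs; but the rewards separate the two vertices only
  through the energy \<open>\<Sum>(x \<bullet> e\<^sub>i)\<^sup>2\<close>, and high energy is itself costly. Stopping when the energy
  reaches \<open>T (\<delta> / B)\<^sup>2\<close> keeps the Hellinger affinity of the two laws close to \<open>1\<close>. Averaging over all
  vertices gives one with large regret.\<close>

section \<open>The law of the trajectory\<close>

lemma reward_kernel: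
  fixes \<theta> :: "real^'n"
  assumes "\<sigma> > 0"
  shows "reward_dist \<sigma> \<theta> \<in> borel \<rightarrow>\<^sub>M prob_algebra borel"
proof (rule measurable_prob_algebraI)
  fix x :: "real^'n"
  show "prob_space (reward_dist \<sigma> \<theta> x)"
    unfolding reward_dist_def by (rule prob_space_normal_density[OF assms])
next
  have m: "(\<lambda>p. normal_density (fst p \<bullet> \<theta>) \<sigma> (snd p)) \<in> borel_measurable (borel \<Otimes>\<^sub>M lborel)"
    unfolding normal_density_def by measurable
  show "reward_dist \<sigma> \<theta> \<in> borel \<rightarrow>\<^sub>M subprob_algebra borel"
  proof (rule measurable_subprob_algebra)
    fix x :: "real^'n"
    show "subprob_space (reward_dist \<sigma> \<theta> x)"
      unfolding reward_dist_def
      by (rule prob_space_imp_subprob_space[OF prob_space_normal_density[OF assms]])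
    show "sets (reward_dist \<sigma> \<theta> x) = sets borel"
      by (simp add: reward_dist_def)
  next
    fix S :: "real set" assume S [measurable]: "S \<in> sets borel"
    have "(\<lambda>x. emeasure (reward_dist \<sigma> \<theta> x) S) =
      (\<lambda>x. \<integral>\<^sup>+y. ennreal (normal_density (x \<bullet> \<theta>) \<sigma> y) * indicator S y \<partial>lborel)"
      by (auto simp: reward_dist_def emeasure_density)
    also have "\<dots> \<in> borel_measurable borel"
      using m by measurable
    finally show "(\<lambda>x. emeasure (reward_dist \<sigma> \<theta> x) S) \<in> borel_measurable borel" .
  qed
qed

lemma nn_integral_normal_density:
  assumes "\<sigma> > 0"
  shows "(\<integral>\<^sup>+y. ennreal (normal_density \<mu> \<sigma> y) \<partial>lborel) = 1"
proof -
  interpret prob_space "density lborel (normal_density \<mu> \<sigma>)"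
    by (rule prob_space_normal_density[OF assms])
  show ?thesis
    using emeasure_space_1 by (simp add: emeasure_density)
qed

lemma hist_space_upd:
  assumes "f \<in> N \<rightarrow>\<^sub>M hist_space t" "k \<in> N \<rightarrow>\<^sub>M borel"
  shows "(\<lambda>x. (f x)(t := k x)) \<in> N \<rightarrow>\<^sub>M hist_space (Suc t)"
  using assms unfolding hist_space_def
  by (intro measurable_fun_upd[where J="{..<t}"]) (auto simp: lessThan_Suc)

lemma hist_space_component:
  "s < t \<Longrightarrow> (\<lambda>h. h s) \<in> hist_space t \<rightarrow>\<^sub>M borel"
  unfolding hist_space_def by (rule measurable_component_singleton) simp

section \<open>The Markov kernel of one round\<close>

locale bandit =
  fixes pol :: "nat \<Rightarrow> (nat \<Rightarrow> (real^'n::finite) \<times> real) \<Rightarrow> (real^'n) measure" and \<sigma> :: real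
  assumes sigma: "\<sigma> > 0"
    and policy [measurable]: "\<And>t. pol t \<in> hist_space t \<rightarrow>\<^sub>M prob_algebra borel"
begin

text \<open>The kernel bound in the recursion of \<open>traj\<close>, as an object of its own: the
  law of a trajectory is an iterated composition of Markov kernels, and inductions on time peel off
  the last round.\<close>

definition play_round :: "real^'n \<Rightarrow> nat \<Rightarrow> (nat \<Rightarrow> (real^'n) \<times> real) \<Rightarrow> (nat \<Rightarrow> (real^'n) \<times> real) measure" where
  "play_round \<theta> t h = pol t h \<bind> (\<lambda>x. distr (reward_dist \<sigma> \<theta> x) (hist_space (Suc t)) (\<lambda>y. h(t := (x, y))))"

lemma play_round_kernel [measurable]: "play_round \<theta> t \<in> hist_space t \<rightarrow>\<^sub>M prob_algebra (hist_space (Suc t))"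
proof -
  have *: "(\<lambda>((h, x), y). h(t := (x, y))) \<in>
     (hist_space t \<Otimes>\<^sub>M borel) \<Otimes>\<^sub>M borel \<rightarrow>\<^sub>M hist_space (Suc t)"
    unfolding case_prod_beta by (intro hist_space_upd) auto
  have **: "(\<lambda>(h, x). distr (reward_dist \<sigma> \<theta> x) (hist_space (Suc t)) (\<lambda>y. h(t := (x, y))))
     \<in> hist_space t \<Otimes>\<^sub>M borel \<rightarrow>\<^sub>M prob_algebra (hist_space (Suc t))"
    unfolding case_prod_beta
    by (rule measurable_distr_prob_space2[where M=borel,
          OF measurable_compose[OF measurable_snd reward_kernel[OF sigma]]])
      (use * in \<open>simp add: case_prod_beta'\<close>)
  show ?thesis
    unfolding play_round_def by (rule measurable_bind_prob_space2[OF policy **])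
qed

lemma traj_Suc: "traj pol \<sigma> \<theta> (Suc t) = traj pol \<sigma> \<theta> t \<bind> play_round \<theta> t"
  by (simp add: play_round_def[abs_def])

declare traj.simps(2) [simp del]

lemma traj_prob_algebra: "traj pol \<sigma> \<theta> t \<in> space (prob_algebra (hist_space t))"
proof (induction t)
  case 0
  have "(\<lambda>_. undefined) \<in> space (hist_space 0 :: (nat \<Rightarrow> (real^'n) \<times> real) measure)"
    by (simp add: hist_space_def space_PiM)
  then show ?case
    by (auto simp: space_prob_algebra intro: prob_space_return)
next
  case (Suc t)
  show ?case
    unfolding traj_Suc
    using measurable_space[OF measurable_bind_prob_space[OF measurable_const[OF Suc] play_round_kernel],
        of "()" "count_space UNIV"] by simp
qed

lemma sets_traj [simp, measurable_cong]: "sets (traj pol \<sigma> \<theta> t) = sets (hist_space t)"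
  using traj_prob_algebra[of \<theta> t] by (simp add: space_prob_algebra)

lemma space_traj [simp]: "space (traj pol \<sigma> \<theta> t) = space (hist_space t)"
  using sets_traj by (rule sets_eq_imp_space_eq)

lemma prob_space_traj: "prob_space (traj pol \<sigma> \<theta> t)"
  using traj_prob_algebra[of \<theta> t] by (simp add: space_prob_algebra)

text \<open>The reward enters through an explicit density. All parameters share the action kernel
  \<open>pol t h\<close>, so two laws can be compared through their densities, pointwise in action
  and reward.\<close>

lemma nn_integral_play_round:
  assumes h: "h \<in> space (hist_space t)" and [measurable]: "f \<in> borel_measurable (hist_space (Suc t))"
  shows "(\<integral>\<^sup>+k. f k \<partial>play_round \<theta> t h) =
    (\<integral>\<^sup>+x. \<integral>\<^sup>+y. ennreal (normal_density (x \<bullet> \<theta>) \<sigma> y) * f (h(t := (x, y))) \<partial>lborel \<partial>pol t h)"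
proof -
  have sp: "sets (pol t h) = sets borel"
    using measurable_space[OF policy h] by (simp add: space_prob_algebra)
  have *: "(\<lambda>(x, y). h(t := (x, y))) \<in> borel \<Otimes>\<^sub>M borel \<rightarrow>\<^sub>M hist_space (Suc t)"
    unfolding case_prod_beta using h by (intro hist_space_upd) (auto simp: borel_prod)
  have "(\<lambda>x. distr (reward_dist \<sigma> \<theta> x) (hist_space (Suc t)) (\<lambda>y. h(t := (x, y))))
     \<in> borel \<rightarrow>\<^sub>M prob_algebra (hist_space (Suc t))"
    by (rule measurable_distr_prob_space2[where M=borel])
      (use * reward_kernel[OF sigma] in \<open>simp_all add: case_prod_beta\<close>)
  then have **: "(\<lambda>x. distr (reward_dist \<sigma> \<theta> x) (hist_space (Suc t)) (\<lambda>y. h(t := (x, y))))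
     \<in> pol t h \<rightarrow>\<^sub>M subprob_algebra (hist_space (Suc t))"
    using sp by (auto dest: measurable_prob_algebraD cong: measurable_cong_sets)
  have up: "(\<lambda>y. h(t := (x, y))) \<in> borel \<rightarrow>\<^sub>M hist_space (Suc t)" for x
    using h by (intro hist_space_upd) auto
  have up': "(\<lambda>y. h(t := (x, y))) \<in> reward_dist \<sigma> \<theta> x \<rightarrow>\<^sub>M hist_space (Suc t)" for x
    using up[of x] by (simp add: reward_dist_def cong: measurable_cong_sets)
  have fm: "(\<lambda>y. f (h(t := (x, y)))) \<in> borel_measurable borel" for x
    using measurable_compose[OF up assms(2)] .
  have "(\<integral>\<^sup>+k. f k \<partial>distr (reward_dist \<sigma> \<theta> x) (hist_space (Suc t)) (\<lambda>y. h(t := (x, y)))) =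
      (\<integral>\<^sup>+y. ennreal (normal_density (x \<bullet> \<theta>) \<sigma> y) * f (h(t := (x, y))) \<partial>lborel)" for x
    by (subst nn_integral_distr[OF up']) (simp_all add: assms(2) reward_dist_def nn_integral_density fm)
  then show ?thesis
    unfolding play_round_def nn_integral_bind[OF assms(2) **] by simp
qed

lemma nn_integral_traj_Suc:
  assumes "f \<in> borel_measurable (hist_space (Suc t))"
  shows "(\<integral>\<^sup>+k. f k \<partial>traj pol \<sigma> \<theta> (Suc t)) = (\<integral>\<^sup>+h. \<integral>\<^sup>+k. f k \<partial>play_round \<theta> t h \<partial>traj pol \<sigma> \<theta> t)"
  unfolding traj_Suc
  by (rule nn_integral_bind[OF assms])
    (use measurable_prob_algebraD[OF play_round_kernel] in \<open>simp cong: measurable_cong_sets\<close>)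

lemma play_round_integral_measurable [measurable]:
  assumes "f \<in> borel_measurable (hist_space (Suc t))"
  shows "(\<lambda>h. \<integral>\<^sup>+k. f k \<partial>play_round \<theta> t h) \<in> borel_measurable (hist_space t)"
  by (rule measurable_compose[OF measurable_prob_algebraD[OF play_round_kernel]
       nn_integral_measurable_subprob_algebra[OF assms]])

lemma prob_space_play_round: "h \<in> space (hist_space t) \<Longrightarrow> prob_space (play_round \<theta> t h)"
  using measurable_space[OF play_round_kernel] by (auto simp: space_prob_algebra)

end

section \<open>Testing two parameters\<close>

text \<open>With Gaussian noise, the information that the rewards carry about a shift of the
  parameter along \<open>g\<close> is proportional to this sum. It reads actions only, so
  \<open>energy g (Suc t)\<close> is known before the reward of round \<open>t\<close>.\<close>

definition energy :: "real^'n \<Rightarrow> nat \<Rightarrow> (nat \<Rightarrow> (real^'n) \<times> real) \<Rightarrow> real" where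
  "energy g t h = (\<Sum>s<t. (fst (h s) \<bullet> g)\<^sup>2)"

lemma energy_Suc: "energy g (Suc t) h = energy g t h + (fst (h t) \<bullet> g)\<^sup>2"
  by (simp add: energy_def)

lemma energy_upd [simp]: "s \<le> t \<Longrightarrow> energy g s (h(t := p)) = energy g s h"
  by (simp add: energy_def)

lemma energy_nonneg: "0 \<le> energy g t h"
  by (simp add: energy_def sum_nonneg)

lemma energy_mono: "s \<le> t \<Longrightarrow> energy g s h \<le> energy g t h"
  unfolding energy_def by (rule sum_mono2) auto

lemma hist_fst_measurable: "s < t \<Longrightarrow> (\<lambda>h. fst (h s)) \<in> hist_space t \<rightarrow>\<^sub>M borel"
  by (rule measurable_compose[OF hist_space_component]) (simp_all add: borel_prod[symmetric])

lemma hist_snd_measurable: "s < t \<Longrightarrow> (\<lambda>h. snd (h s)) \<in> hist_space t \<rightarrow>\<^sub>M borel"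
  by (rule measurable_compose[OF hist_space_component]) (simp_all add: borel_prod[symmetric])

lemma energy_measurable:
  "s \<le> t \<Longrightarrow> energy g s \<in> borel_measurable (hist_space t)"
  unfolding energy_def[abs_def]
  by (intro borel_measurable_sum borel_measurable_power borel_measurable_inner
      hist_fst_measurable borel_measurable_const) simp

section \<open>Likelihood ratios and losses stopped at an energy level\<close>

context bandit
begin

text \<open>The action contributes no factor: the policy is the same under both parameters and
  cancels.\<close>

definition lratio :: "real^'n \<Rightarrow> real^'n \<Rightarrow> (real^'n) \<times> real \<Rightarrow> real" where
  "lratio \<alpha> \<gamma> p = normal_density (fst p \<bullet> \<gamma>) \<sigma> (snd p) / normal_density (fst p \<bullet> \<alpha>) \<sigma> (snd p)"

text \<open>Round \<open>s\<close> contributes only if the energy is still below \<open>K\<close> after its action. If round \<open>t\<close>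
  counts in \<open>stopped_loss\<close>, then all earlier factors are therefore present and \<open>stopped_lratio\<close> at
  time \<open>t\<close> is the full likelihood ratio.\<close>

definition stopped_lratio ::
    "real^'n \<Rightarrow> real^'n \<Rightarrow> real^'n \<Rightarrow> real \<Rightarrow> nat \<Rightarrow> (nat \<Rightarrow> (real^'n) \<times> real) \<Rightarrow> real" where
  "stopped_lratio \<alpha> \<gamma> g K t h =
     (\<Prod>s<t. if energy g (Suc s) h < K then lratio \<alpha> \<gamma> (h s) else 1)"

definition stopped_loss ::
    "real \<Rightarrow> real^'n \<Rightarrow> real \<Rightarrow> nat \<Rightarrow> (nat \<Rightarrow> (real^'n) \<times> real) \<Rightarrow> real" where
  "stopped_loss \<eta> g K t h =
     (\<Sum>s<t. if energy g s h < K then (\<eta> - fst (h s) \<bullet> g)\<^sup>2 else 0)"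

lemma lratio_pos: "0 < lratio \<alpha> \<gamma> p"
  by (simp add: lratio_def normal_density_pos[OF sigma])

lemma stopped_lratio_nonneg: "0 \<le> stopped_lratio \<alpha> \<gamma> g K t h"
  unfolding stopped_lratio_def by (rule prod_nonneg) (simp add: lratio_pos less_imp_le)

lemma stopped_loss_nonneg: "0 \<le> stopped_loss \<eta> g K t h"
  unfolding stopped_loss_def by (rule sum_nonneg) simp

lemma stopped_lratio_upd [simp]:
  "stopped_lratio \<alpha> \<gamma> g K t (h(t := p)) = stopped_lratio \<alpha> \<gamma> g K t h"
  unfolding stopped_lratio_def by (rule prod.cong) (auto simp: Suc_le_eq)

lemma stopped_loss_upd [simp]:
  "stopped_loss \<eta> g K t (h(t := p)) = stopped_loss \<eta> g K t h"
  unfolding stopped_loss_def by (rule sum.cong) auto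

lemma lratio_measurable:
  "s < t \<Longrightarrow> (\<lambda>h. lratio \<alpha> \<gamma> (h s)) \<in> borel_measurable (hist_space t)"
  using hist_fst_measurable[of s t] hist_snd_measurable[of s t]
  unfolding lratio_def normal_density_def by measurable

lemma stopped_lratio_measurable [measurable]:
  "stopped_lratio \<alpha> \<gamma> g K t \<in> borel_measurable (hist_space t)"
  unfolding stopped_lratio_def[abs_def]
proof (rule borel_measurable_prod)
  fix s assume "s \<in> {..<t}"
  then have "s < t" "Suc s \<le> t" by auto
  then show "(\<lambda>h. if energy g (Suc s) h < K then lratio \<alpha> \<gamma> (h s) else 1) \<in> borel_measurable (hist_space t)"
    using lratio_measurable[of s t \<alpha> \<gamma>] energy_measurable[of "Suc s" t g] by measurable
qed

lemma stopped_loss_summand_measurable: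
  "s < t \<Longrightarrow> (\<lambda>h. if energy g s h < K then (\<eta> - fst (h s) \<bullet> g)\<^sup>2 else 0) \<in> borel_measurable (hist_space t)"
  using hist_fst_measurable[of s t] energy_measurable[of s t g] by measurable

lemma stopped_loss_measurable [measurable]:
  "stopped_loss \<eta> g K t \<in> borel_measurable (hist_space t)"
  unfolding stopped_loss_def[abs_def]
  by (rule borel_measurable_sum) (simp add: stopped_loss_summand_measurable)

lemma prob_space_policy: "h \<in> space (hist_space t) \<Longrightarrow> prob_space (pol t h)"
  using measurable_space[OF policy] by (auto simp: space_prob_algebra)

text \<open>The stopped likelihood ratio is a martingale for the filtration that reveals the next action
  before its reward.\<close>

lemma nn_integral_stopped_lratio_Suc:
  assumes "\<And>y. f (h(t := (x, y))) = c"
  shows "(\<integral>\<^sup>+y. ennreal (normal_density (x \<bullet> \<alpha>) \<sigma> y) *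
      (ennreal (stopped_lratio \<alpha> \<gamma> g K (Suc t) (h(t := (x, y)))) * f (h(t := (x, y)))) \<partial>lborel) =
    ennreal (stopped_lratio \<alpha> \<gamma> g K t h) * c"
proof -
  \<comment> \<open>Whether round \<open>t\<close> counts depends on its action alone. For fixed
    \<open>x\<close> the integrand is therefore a constant times one normal density in
    \<open>y\<close>, with mean taken from \<open>\<gamma>\<close> if the round counts and from
    \<open>\<alpha>\<close> otherwise; both have mass 1.\<close>
  define \<mu> where "\<mu> = (if energy g t h + (x \<bullet> g)\<^sup>2 < K then x \<bullet> \<gamma> else x \<bullet> \<alpha>)"
  have pos: "0 < normal_density m \<sigma> y" for m y
    by (rule normal_density_pos[OF sigma])
  have "normal_density (x \<bullet> \<alpha>) \<sigma> y * stopped_lratio \<alpha> \<gamma> g K (Suc t) (h(t := (x, y))) =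
      stopped_lratio \<alpha> \<gamma> g K t h * normal_density \<mu> \<sigma> y" for y
    using pos[of "x \<bullet> \<alpha>" y] stopped_lratio_upd[of \<alpha> \<gamma> g K t h "(x, y)"]
    by (simp add: stopped_lratio_def lratio_def \<mu>_def energy_Suc)
  then have "ennreal (normal_density (x \<bullet> \<alpha>) \<sigma> y) *
      (ennreal (stopped_lratio \<alpha> \<gamma> g K (Suc t) (h(t := (x, y)))) * f (h(t := (x, y)))) =
      ennreal (normal_density \<mu> \<sigma> y) * (ennreal (stopped_lratio \<alpha> \<gamma> g K t h) * c)" for y
    by (simp add: assms ennreal_mult[symmetric] mult.assoc[symmetric] stopped_lratio_nonneg
        mult.commute[of "stopped_lratio \<alpha> \<gamma> g K t h"])
  then show ?thesis
    by (simp add: nn_integral_multc nn_integral_normal_density[OF sigma])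
qed

text \<open>When \<open>f\<close> ignores the reward, the normal density integrates to 1 and
  \<open>\<theta>\<close> disappears from the value.\<close>

lemma nn_integral_play_round_action:
  assumes "h \<in> space (hist_space t)" "f \<in> borel_measurable (hist_space (Suc t))"
    and c: "\<And>x y. f (h(t := (x, y))) = c x"
  shows "(\<integral>\<^sup>+k. f k \<partial>play_round \<theta> t h) = (\<integral>\<^sup>+x. c x \<partial>pol t h)"
  by (simp add: nn_integral_play_round[OF assms(1,2)] c nn_integral_multc
      nn_integral_normal_density[OF sigma])

text \<open>Given the action, the last factor of the ratio has mean 1, so it drops out against any
  \<open>f\<close> that ignores the last reward.\<close>

lemma nn_integral_stopped_lratio_play_round:
  assumes h: "h \<in> space (hist_space t)" and f: "f \<in> borel_measurable (hist_space (Suc t))"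
    and c: "\<And>x y. f (h(t := (x, y))) = c x"
  shows "(\<integral>\<^sup>+k. ennreal (stopped_lratio \<alpha> \<gamma> g K (Suc t) k) * f k \<partial>play_round \<alpha> t h) =
    ennreal (stopped_lratio \<alpha> \<gamma> g K t h) * (\<integral>\<^sup>+k. f k \<partial>play_round \<alpha> t h)"
proof -
  have [measurable_cong]: "sets (play_round \<alpha> t h) = sets (hist_space (Suc t))"
    using measurable_space[OF play_round_kernel h] by (simp add: space_prob_algebra)
  have "(\<integral>\<^sup>+k. ennreal (stopped_lratio \<alpha> \<gamma> g K (Suc t) k) * f k \<partial>play_round \<alpha> t h) =
      (\<integral>\<^sup>+x. ennreal (stopped_lratio \<alpha> \<gamma> g K t h) * c x \<partial>pol t h)"
    using f by (simp add: nn_integral_play_round[OF h] nn_integral_stopped_lratio_Suc[where f=f, OF c])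
  also have "\<dots> = (\<integral>\<^sup>+k. ennreal (stopped_lratio \<alpha> \<gamma> g K t h) * f k \<partial>play_round \<alpha> t h)"
    by (rule nn_integral_play_round_action[symmetric, OF h]) (use f c in auto)
  also have "\<dots> = ennreal (stopped_lratio \<alpha> \<gamma> g K t h) * (\<integral>\<^sup>+k. f k \<partial>play_round \<alpha> t h)"
    using f by (intro nn_integral_cmult) measurable
  finally show ?thesis .
qed

lemma nn_integral_stopped_lratio:
  "(\<integral>\<^sup>+h. ennreal (stopped_lratio \<alpha> \<gamma> g K t h) \<partial>traj pol \<sigma> \<alpha> t) = 1"
proof (induction t)
  case 0
  then show ?case
    using prob_space.emeasure_space_1[OF prob_space_traj[of \<alpha> 0]]
    by (simp add: stopped_lratio_def del: traj.simps)
next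
  case (Suc t)
  have "(\<integral>\<^sup>+h. ennreal (stopped_lratio \<alpha> \<gamma> g K (Suc t) h) \<partial>traj pol \<sigma> \<alpha> (Suc t)) =
    (\<integral>\<^sup>+h. \<integral>\<^sup>+k. ennreal (stopped_lratio \<alpha> \<gamma> g K (Suc t) k) * 1 \<partial>play_round \<alpha> t h \<partial>traj pol \<sigma> \<alpha> t)"
    by (simp add: nn_integral_traj_Suc)
  also have "\<dots> = (\<integral>\<^sup>+h. ennreal (stopped_lratio \<alpha> \<gamma> g K t h) \<partial>traj pol \<sigma> \<alpha> t)"
    by (intro nn_integral_cong, subst nn_integral_stopped_lratio_play_round)
      (auto simp: prob_space.emeasure_space_1[OF prob_space_play_round])
  finally show ?case using Suc by simp
qed

text \<open>Where \<open>f\<close> does not vanish, the energy has stayed below \<open>K\<close>, no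
  factor has been replaced by 1, and \<open>stopped_lratio\<close> is the full density
  ratio.\<close>

lemma change_of_measure:
  assumes "f \<in> borel_measurable (hist_space t)" "\<And>h. K \<le> energy g t h \<Longrightarrow> f h = 0"
  shows "(\<integral>\<^sup>+h. f h \<partial>traj pol \<sigma> \<gamma> t) =
    (\<integral>\<^sup>+h. ennreal (stopped_lratio \<alpha> \<gamma> g K t h) * f h \<partial>traj pol \<sigma> \<alpha> t)"
  using assms
proof (induction t arbitrary: f)
  case 0
  then show ?case by (simp add: stopped_lratio_def)
next
  case (Suc t)
  note [measurable] = Suc.prems(1)
  have "(\<integral>\<^sup>+k. f k \<partial>traj pol \<sigma> \<gamma> (Suc t)) = (\<integral>\<^sup>+h. \<integral>\<^sup>+k. f k \<partial>play_round \<gamma> t h \<partial>traj pol \<sigma> \<gamma> t)"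
    by (rule nn_integral_traj_Suc) simp
  \<comment> \<open>Energy never decreases, so \<open>f\<close> vanishes on every continuation of a
    history that has reached \<open>K\<close>. The indicator makes this visible as the vanishing
    condition of the induction hypothesis.\<close>
  also have "\<dots> = (\<integral>\<^sup>+h. (\<integral>\<^sup>+k. f k \<partial>play_round \<gamma> t h) * indicator {h. energy g t h < K} h \<partial>traj pol \<sigma> \<gamma> t)"
  proof (rule nn_integral_cong)
    fix h :: "nat \<Rightarrow> (real^'n) \<times> real" assume "h \<in> space (traj pol \<sigma> \<gamma> t)"
    then have h: "h \<in> space (hist_space t)" by simp
    have "f (h(t := (x, y))) = 0" if "K \<le> energy g t h" for x y
      using that energy_mono[of t "Suc t" g "h(t := (x, y))"]
      by (intro Suc.prems(2)) (simp del: fun_upd_apply)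
    then have "(\<integral>\<^sup>+k. f k \<partial>play_round \<gamma> t h) = 0" if "K \<le> energy g t h"
      using that by (simp add: nn_integral_play_round[OF h])
    then show "(\<integral>\<^sup>+k. f k \<partial>play_round \<gamma> t h) =
        (\<integral>\<^sup>+k. f k \<partial>play_round \<gamma> t h) * indicator {h. energy g t h < K} h"
      by (cases "energy g t h < K") auto
  qed
  also have "\<dots> = (\<integral>\<^sup>+h. ennreal (stopped_lratio \<alpha> \<gamma> g K t h) *
      ((\<integral>\<^sup>+k. f k \<partial>play_round \<gamma> t h) * indicator {h. energy g t h < K} h) \<partial>traj pol \<sigma> \<alpha> t)"
    using energy_measurable[of t t g] by (intro Suc.IH) (auto, measurable)
  also have "\<dots> = (\<integral>\<^sup>+h. \<integral>\<^sup>+k. ennreal (stopped_lratio \<alpha> \<gamma> g K (Suc t) k) * f k \<partial>play_round \<alpha> t h \<partial>traj pol \<sigma> \<alpha> t)"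
  proof (rule nn_integral_cong)
    fix h :: "nat \<Rightarrow> (real^'n) \<times> real" assume "h \<in> space (traj pol \<sigma> \<alpha> t)"
    then have h: "h \<in> space (hist_space t)" by simp
    \<comment> \<open>Below \<open>K\<close> after round \<open>t\<close>, the last factor trades
      the \<open>\<alpha>\<close> density for the \<open>\<gamma>\<close> density; if the action of
      round \<open>t\<close> brings the energy to \<open>K\<close>, both sides are 0 because
      \<open>f\<close> is.\<close>
    have *: "ennreal (stopped_lratio \<alpha> \<gamma> g K t h) * indicator {h. energy g t h < K} h *
        (ennreal (normal_density (x \<bullet> \<gamma>) \<sigma> y) * f (h(t := (x, y)))) =
      ennreal (normal_density (x \<bullet> \<alpha>) \<sigma> y) *
        (ennreal (stopped_lratio \<alpha> \<gamma> g K (Suc t) (h(t := (x, y)))) * f (h(t := (x, y))))" for x y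
    proof (cases "energy g (Suc t) (h(t := (x, y))) < K")
      case True
      moreover have "energy g t h < K"
        using True energy_mono[of t "Suc t" g "h(t := (x, y))"] by simp
      moreover have "stopped_lratio \<alpha> \<gamma> g K t h * normal_density (x \<bullet> \<gamma>) \<sigma> y =
          normal_density (x \<bullet> \<alpha>) \<sigma> y * stopped_lratio \<alpha> \<gamma> g K (Suc t) (h(t := (x, y)))"
        using True normal_density_pos[OF sigma, of "x \<bullet> \<alpha>" y]
          stopped_lratio_upd[of \<alpha> \<gamma> g K t h "(x, y)"]
        by (simp add: stopped_lratio_def lratio_def)
      ultimately show ?thesis
        by (simp add: ennreal_mult[symmetric] mult.assoc[symmetric] stopped_lratio_nonneg)
    next
      case False
      then have "f (h(t := (x, y))) = 0" by (intro Suc.prems(2)) (simp del: fun_upd_apply)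
      then show ?thesis by simp
    qed
    have sp: "sets (pol t h) = sets borel"
      using measurable_space[OF policy h] by (simp add: space_prob_algebra)
    have up: "(\<lambda>(x, y). h(t := (x, y))) \<in> borel \<Otimes>\<^sub>M borel \<rightarrow>\<^sub>M hist_space (Suc t)"
      unfolding case_prod_beta using h by (intro hist_space_upd) (auto simp: borel_prod)
    have fm: "(\<lambda>(x, y). ennreal (normal_density (x \<bullet> \<gamma>) \<sigma> y) * f (h(t := (x, y))))
        \<in> borel_measurable (borel \<Otimes>\<^sub>M lborel)"
    proof -
      have [measurable]: "(\<lambda>p. f (h(t := (fst p, snd p)))) \<in> borel_measurable (borel \<Otimes>\<^sub>M lborel)"
        using measurable_compose[OF up Suc.prems(1)]
        by (simp add: case_prod_beta' del: fun_upd_apply cong: measurable_cong_sets)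
      show ?thesis
        unfolding normal_density_def case_prod_beta' by measurable
    qed
    have inner: "(\<lambda>y. ennreal (normal_density (x \<bullet> \<gamma>) \<sigma> y) * f (h(t := (x, y)))) \<in> borel_measurable lborel" for x
      using measurable_compose[OF measurable_Pair1' fm, of x] by simp
    have outer: "(\<lambda>x. \<integral>\<^sup>+y. ennreal (normal_density (x \<bullet> \<gamma>) \<sigma> y) * f (h(t := (x, y))) \<partial>lborel)
        \<in> borel_measurable (pol t h)"
      using lborel.borel_measurable_nn_integral[OF fm] sp by (simp cong: measurable_cong_sets)
    have "ennreal (stopped_lratio \<alpha> \<gamma> g K t h) *
        ((\<integral>\<^sup>+k. f k \<partial>play_round \<gamma> t h) * indicator {h. energy g t h < K} h) =
      (\<integral>\<^sup>+x. \<integral>\<^sup>+y. ennreal (stopped_lratio \<alpha> \<gamma> g K t h) * indicator {h. energy g t h < K} h *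
        (ennreal (normal_density (x \<bullet> \<gamma>) \<sigma> y) * f (h(t := (x, y)))) \<partial>lborel \<partial>pol t h)"
      unfolding nn_integral_cmult[OF inner] nn_integral_cmult[OF outer]
        nn_integral_play_round[OF h Suc.prems(1)] by (simp only: mult_ac)
    also have "\<dots> = (\<integral>\<^sup>+k. ennreal (stopped_lratio \<alpha> \<gamma> g K (Suc t) k) * f k \<partial>play_round \<alpha> t h)"
      by (simp add: * nn_integral_play_round[OF h])
    finally show "ennreal (stopped_lratio \<alpha> \<gamma> g K t h) *
        ((\<integral>\<^sup>+k. f k \<partial>play_round \<gamma> t h) * indicator {h. energy g t h < K} h) =
      (\<integral>\<^sup>+k. ennreal (stopped_lratio \<alpha> \<gamma> g K (Suc t) k) * f k \<partial>play_round \<alpha> t h)" .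
  qed
  also have "\<dots> = (\<integral>\<^sup>+k. ennreal (stopped_lratio \<alpha> \<gamma> g K (Suc t) k) * f k \<partial>traj pol \<sigma> \<alpha> (Suc t))"
    by (rule nn_integral_traj_Suc[symmetric]) measurable
  finally show ?case .
qed

end

lemma energy_minus [simp]: "energy (- g) t h = energy g t h"
  by (simp add: energy_def)

text \<open>With \<open>q\<close> a likelihood ratio and \<open>m\<^sup>2\<close> at most about \<open>q\<close>, integrating this inequality bounds the overlap
  \<open>\<integral>min 1 q\<close> from below by the affinity; it is linear in \<open>m\<close>, \<open>q\<close> and \<open>min 1 q\<close>, so no Cauchy-Schwarz
  is needed. The constants come from \<open>4 \<surd>q \<le> 3 min 1 q + 1 + q\<close> and \<open>exp (1/16) \<le> (8/7)\<^sup>2\<close>.\<close>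

lemma three_min_bound:
  fixes m q :: real
  assumes "0 \<le> q" "0 \<le> m" "m\<^sup>2 \<le> q * exp (1/16)"
  shows "7/2 * m \<le> 3 * min 1 q + 1 + q"
proof -
  define s where "s = sqrt q"
  have s: "0 \<le> s" "s\<^sup>2 = q" using assms by (simp_all add: s_def)
  have "exp (1/16 :: real) \<le> 1 + 1/16 + (1/16)\<^sup>2"
    by (rule exp_bound) auto
  then have "exp (1/16 :: real) \<le> (8/7)\<^sup>2"
    by (simp add: power2_eq_square)
  then have "m\<^sup>2 \<le> q * (8/7)\<^sup>2"
    using assms(1,3) by (meson mult_left_mono order_trans)
  then have "m\<^sup>2 \<le> (8/7 * s)\<^sup>2"
    unfolding power_mult_distrib s by (simp only: mult.commute)
  then have "7/2 * m \<le> 4 * s"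
    using s by (simp add: power2_le_iff_abs_le assms(2))
  also have "4 * s \<le> 3 * min 1 q + 1 + q"
  proof (cases "q \<le> 1")
    case True
    have "0 \<le> (2 * s - 1)\<^sup>2" by simp
    then show ?thesis using True s by (simp add: power2_eq_square algebra_simps)
  next
    case False
    have "0 \<le> (s - 2)\<^sup>2" by simp
    then show ?thesis using False s by (simp add: power2_eq_square algebra_simps)
  qed
  finally show ?thesis .
qed

section \<open>Losses under two parameters and the overlap of their laws\<close>

context bandit
begin

lemma stopped_loss_Suc: "stopped_loss \<eta> g K (Suc t) h =
    stopped_loss \<eta> g K t h + (if energy g t h < K then (\<eta> - fst (h t) \<bullet> g)\<^sup>2 else 0)"
  by (simp add: stopped_loss_def)

lemma stopped_lratio_minus [simp]: "stopped_lratio \<alpha> \<gamma> (- g) K t h = stopped_lratio \<alpha> \<gamma> g K t h"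
  by (simp add: stopped_lratio_def)

text \<open>The total loss does not vanish once the energy reaches \<open>K\<close>, so the change
  of measure is applied round by round. The crossing round counts in the loss but has no factor in
  the ratio; this is harmless, since its loss depends on the action and not on the reward.\<close>

lemma stopped_loss_change:
  "(\<integral>\<^sup>+h. ennreal (stopped_loss \<eta> g K t h) \<partial>traj pol \<sigma> \<gamma> t) =
   (\<integral>\<^sup>+h. ennreal (stopped_lratio \<alpha> \<gamma> g K t h) * ennreal (stopped_loss \<eta> g K t h) \<partial>traj pol \<sigma> \<alpha> t)"
proof (induction t)
  case 0
  show ?case by (simp add: stopped_loss_def)
next
  case (Suc t)
  let ?L = "\<lambda>t h. ennreal (stopped_loss \<eta> g K t h)"
  let ?Q = "\<lambda>t h. ennreal (stopped_lratio \<alpha> \<gamma> g K t h)"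
  define l where "l h x = ennreal (if energy g t h < K then (\<eta> - x \<bullet> g)\<^sup>2 else 0)"
    for h :: "nat \<Rightarrow> (real^'n) \<times> real" and x
  \<comment> \<open>The expected loss of round \<open>t\<close> given the past. It involves the
    policy only, hence is the same function of the history under every parameter.\<close>
  define W where "W h = (\<integral>\<^sup>+x. l h x \<partial>pol t h)" for h
  have L_upd: "?L (Suc t) (h(t := (x, y))) = ?L t h + l h x" for h x y
    using stopped_loss_upd[of \<eta> g K t h "(x, y)"]
    by (simp add: stopped_loss_Suc l_def ennreal_plus stopped_loss_nonneg del: ennreal_plus_if)
  have l_meas: "(\<lambda>(h, x). l h x) \<in> borel_measurable (hist_space t \<Otimes>\<^sub>M borel)"
    using energy_measurable[of t t g] unfolding l_def by measurable
  have W_meas: "W \<in> borel_measurable (hist_space t)"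
    unfolding W_def[abs_def]
    by (rule nn_integral_measurable_subprob_algebra2[OF l_meas measurable_prob_algebraD[OF policy]])
  have round_loss: "(\<integral>\<^sup>+k. ?L (Suc t) k \<partial>play_round \<theta> t h) = ?L t h + W h"
    if h: "h \<in> space (hist_space t)" for h \<theta>
  proof -
    interpret P: prob_space "pol t h" by (rule prob_space_policy[OF h])
    have sp: "sets (pol t h) = sets borel"
      using measurable_space[OF policy h] by (simp add: space_prob_algebra)
    have lm: "l h \<in> borel_measurable (pol t h)"
      using measurable_compose[OF measurable_Pair1'[OF h] l_meas] sp
      by (simp cong: measurable_cong_sets)
    have "(\<integral>\<^sup>+k. ?L (Suc t) k \<partial>play_round \<theta> t h) = (\<integral>\<^sup>+x. ?L t h + l h x \<partial>pol t h)"
      by (rule nn_integral_play_round_action[OF h]) (simp, rule L_upd)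
    also have "\<dots> = ?L t h + W h"
      using lm by (simp add: nn_integral_add W_def P.emeasure_space_1)
    finally show ?thesis .
  qed
  have W_zero: "W h = 0" if "K \<le> energy g t h" for h
    using that by (simp add: W_def l_def)
  note [measurable] = W_meas
  have "(\<integral>\<^sup>+h. ?L (Suc t) h \<partial>traj pol \<sigma> \<gamma> (Suc t)) = (\<integral>\<^sup>+h. ?L t h + W h \<partial>traj pol \<sigma> \<gamma> t)"
    by (simp add: nn_integral_traj_Suc round_loss cong: nn_integral_cong_simp)
  also have "\<dots> = (\<integral>\<^sup>+h. ?L t h \<partial>traj pol \<sigma> \<gamma> t) + (\<integral>\<^sup>+h. W h \<partial>traj pol \<sigma> \<gamma> t)"
    by (rule nn_integral_add) measurable
  \<comment> \<open>The past loss changes measure by induction; the new one by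
    \<open>change_of_measure\<close>, as \<open>W\<close> vanishes from energy \<open>K\<close>
    on.\<close>
  also have "\<dots> = (\<integral>\<^sup>+h. ?Q t h * ?L t h \<partial>traj pol \<sigma> \<alpha> t) + (\<integral>\<^sup>+h. ?Q t h * W h \<partial>traj pol \<sigma> \<alpha> t)"
    using change_of_measure[OF W_meas W_zero] by (simp add: Suc.IH)
  also have "\<dots> = (\<integral>\<^sup>+h. ?Q t h * (?L t h + W h) \<partial>traj pol \<sigma> \<alpha> t)"
    unfolding distrib_left by (rule nn_integral_add[symmetric]) measurable
  also have "\<dots> = (\<integral>\<^sup>+h. \<integral>\<^sup>+k. ?Q (Suc t) k * ?L (Suc t) k \<partial>play_round \<alpha> t h \<partial>traj pol \<sigma> \<alpha> t)"
  proof (rule nn_integral_cong)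
    fix h :: "nat \<Rightarrow> (real^'n) \<times> real" assume "h \<in> space (traj pol \<sigma> \<alpha> t)"
    then have h: "h \<in> space (hist_space t)" by simp
    show "?Q t h * (?L t h + W h) = (\<integral>\<^sup>+k. ?Q (Suc t) k * ?L (Suc t) k \<partial>play_round \<alpha> t h)"
      unfolding round_loss[OF h, of \<alpha>, symmetric]
      by (rule nn_integral_stopped_lratio_play_round[symmetric, OF h]) (simp, rule L_upd)
  qed
  also have "\<dots> = (\<integral>\<^sup>+h. ?Q (Suc t) h * ?L (Suc t) h \<partial>traj pol \<sigma> \<alpha> (Suc t))"
    by (rule nn_integral_traj_Suc[symmetric]) measurable
  finally show ?case .
qed

text \<open>Both signs stop together, since the energy is even in \<open>g\<close>. A round before
  stopping adds \<open>2 * \<eta>\<^sup>2 + 2 * (x \<bullet> g)\<^sup>2\<close> for its action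
  \<open>x\<close>, the cross terms cancelling. Once the energy has reached \<open>K\<close>, the
  bound is already saturated at \<open>2 * K\<close>.\<close>

lemma stopped_loss_sum_ge:
  "2 * min K (real t * \<eta>\<^sup>2 + energy g t h) \<le> stopped_loss \<eta> g K t h + stopped_loss \<eta> (- g) K t h"
proof (induction t)
  case 0
  show ?case by (simp add: stopped_loss_def energy_def)
next
  case (Suc t)
  show ?case
  proof (cases "energy g t h < K")
    case True
    have "(\<eta> - fst (h t) \<bullet> g)\<^sup>2 + (\<eta> + fst (h t) \<bullet> g)\<^sup>2 = 2 * \<eta>\<^sup>2 + 2 * (fst (h t) \<bullet> g)\<^sup>2"
      by (simp add: power2_eq_square algebra_simps)
    moreover have "0 \<le> \<eta>\<^sup>2" "0 \<le> (fst (h t) \<bullet> g)\<^sup>2" by simp_all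
    moreover have "2 * min K (real (Suc t) * \<eta>\<^sup>2 + energy g (Suc t) h) \<le>
        2 * min K (real t * \<eta>\<^sup>2 + energy g t h) + 2 * (\<eta>\<^sup>2 + (fst (h t) \<bullet> g)\<^sup>2)"
    proof -
      have "min K (a + b) \<le> min K a + b" if "0 \<le> b" for a b :: real
        using that by (simp add: min_def)
      from this[of "\<eta>\<^sup>2 + (fst (h t) \<bullet> g)\<^sup>2" "real t * \<eta>\<^sup>2 + energy g t h"]
      show ?thesis by (simp add: energy_Suc algebra_simps)
    qed
    ultimately show ?thesis
      using True Suc by (simp add: stopped_loss_Suc)
  next
    case False
    then have "K \<le> real t * \<eta>\<^sup>2 + energy g t h"
      by (simp add: add_increasing)
    then have "2 * K \<le> stopped_loss \<eta> g K t h + stopped_loss \<eta> (- g) K t h"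
      using Suc by simp
    then show ?thesis using False by (simp add: stopped_loss_Suc min_def)
  qed
qed

text \<open>Completing the square in the Gaussian exponents. It expresses the root of the ratio of
  \<open>\<alpha> - 2 *\<^sub>R g\<close> to \<open>\<alpha>\<close>, whose integral is the
  Hellinger affinity, through the ratio at the midpoint \<open>\<alpha> - g\<close>, which has mean
  1.\<close>

lemma lratio_midpoint:
  "(lratio \<alpha> (\<alpha> - g) p)\<^sup>2 = lratio \<alpha> (\<alpha> - 2 *\<^sub>R g) p * exp ((fst p \<bullet> g)\<^sup>2 / \<sigma>\<^sup>2)"
proof -
  define z where "z = snd p - fst p \<bullet> \<alpha>"
  define v where "v = fst p \<bullet> g"
  have "(exp (- (z + v)\<^sup>2 / (2 * \<sigma>\<^sup>2)))\<^sup>2 =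
      exp (- z\<^sup>2 / (2 * \<sigma>\<^sup>2)) * exp (- (z + 2 * v)\<^sup>2 / (2 * \<sigma>\<^sup>2)) * exp (v\<^sup>2 / \<sigma>\<^sup>2)"
    unfolding exp_double[symmetric] exp_add[symmetric] using sigma
    by (simp add: field_simps power2_eq_square)
  moreover have "normal_density (fst p \<bullet> \<alpha>) \<sigma> (snd p) = 1 / sqrt (2 * pi * \<sigma>\<^sup>2) * exp (- z\<^sup>2 / (2 * \<sigma>\<^sup>2))"
    "normal_density (fst p \<bullet> (\<alpha> - g)) \<sigma> (snd p) = 1 / sqrt (2 * pi * \<sigma>\<^sup>2) * exp (- (z + v)\<^sup>2 / (2 * \<sigma>\<^sup>2))"
    "normal_density (fst p \<bullet> (\<alpha> - 2 *\<^sub>R g)) \<sigma> (snd p) = 1 / sqrt (2 * pi * \<sigma>\<^sup>2) * exp (- (z + 2 * v)\<^sup>2 / (2 * \<sigma>\<^sup>2))"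
    by (simp_all add: normal_density_def z_def v_def inner_diff_right algebra_simps)
  ultimately show ?thesis
    using sigma by (simp add: lratio_def v_def[symmetric] power_divide power2_eq_square)
qed

lemma stopped_lratio_midpoint:
  assumes "0 \<le> K"
  shows "(stopped_lratio \<alpha> (\<alpha> - g) g K t h)\<^sup>2 \<le> stopped_lratio \<alpha> (\<alpha> - 2 *\<^sub>R g) g K t h * exp (K / \<sigma>\<^sup>2)"
proof -
  define e where "e t = (\<Sum>s<t. if energy g (Suc s) h < K then (fst (h s) \<bullet> g)\<^sup>2 else 0)" for t
  have "(stopped_lratio \<alpha> (\<alpha> - g) g K t h)\<^sup>2 = stopped_lratio \<alpha> (\<alpha> - 2 *\<^sub>R g) g K t h * exp (e t / \<sigma>\<^sup>2)"
    by (induction t) (auto simp: stopped_lratio_def e_def power_mult_distrib lratio_midpoint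
        add_divide_distrib exp_add)
  \<comment> \<open>The first conjunct feeds the second: if round \<open>t\<close> counts, then
    \<open>e (Suc t) \<le> energy g (Suc t) h < K\<close>. The round that reaches \<open>K\<close>
    does not count, so it cannot overshoot the bound.\<close>
  moreover have "e t \<le> energy g t h \<and> e t \<le> K"
    by (induction t) (use assms in \<open>auto simp: e_def energy_Suc energy_def add_increasing2\<close>)
  then have "exp (e t / \<sigma>\<^sup>2) \<le> exp (K / \<sigma>\<^sup>2)"
    by (simp add: divide_right_mono)
  ultimately show ?thesis
    by (simp add: mult_left_mono stopped_lratio_nonneg)
qed

text \<open>Integrating \<open>three_min_bound\<close> with \<open>m\<close> the midpoint ratio and
  \<open>q\<close> the full-shift ratio, both of mean 1, gives \<open>7/2 \<le> 3 * I + 2\<close>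
  for the overlap \<open>I\<close>.\<close>

lemma stopped_overlap:
  assumes "0 \<le> K" "K / \<sigma>\<^sup>2 \<le> 1/16"
  shows "ennreal (1/2) \<le> (\<integral>\<^sup>+h. ennreal (min 1 (stopped_lratio \<alpha> (\<alpha> - 2 *\<^sub>R g) g K t h)) \<partial>traj pol \<sigma> \<alpha> t)"
    (is "_ \<le> ?I")
proof -
  interpret P: prob_space "traj pol \<sigma> \<alpha> t" by (rule prob_space_traj)
  let ?q = "stopped_lratio \<alpha> (\<alpha> - 2 *\<^sub>R g) g K t" and ?m = "stopped_lratio \<alpha> (\<alpha> - g) g K t"
  have bound: "ennreal (7/2) * ennreal (?m h) \<le> ennreal 3 * ennreal (min 1 (?q h)) + (1 + ennreal (?q h))" for h
  proof -
    have "(?m h)\<^sup>2 \<le> ?q h * exp (1/16)"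
      using stopped_lratio_midpoint[OF assms(1), of \<alpha> g t h] assms(2) stopped_lratio_nonneg
      by (smt (verit) exp_le_cancel_iff mult_left_mono)
    then have "7/2 * ?m h \<le> 3 * min 1 (?q h) + (1 + ?q h)"
      using three_min_bound[of "?q h" "?m h"] by (simp add: stopped_lratio_nonneg)
    then have "ennreal (7/2 * ?m h) \<le> ennreal (3 * min 1 (?q h) + (1 + ?q h))"
      by (rule ennreal_leI)
    then show ?thesis
      unfolding ennreal_1[symmetric]
      by (subst (1 2) ennreal_mult[symmetric], simp_all add: stopped_lratio_nonneg
          del: ennreal_numeral ennreal_1)
  qed
  have "ennreal (7/2) = (\<integral>\<^sup>+h. ennreal (7/2) * ennreal (?m h) \<partial>traj pol \<sigma> \<alpha> t)"
    by (simp add: nn_integral_cmult nn_integral_stopped_lratio)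
  also have "\<dots> \<le> (\<integral>\<^sup>+h. ennreal 3 * ennreal (min 1 (?q h)) + (1 + ennreal (?q h)) \<partial>traj pol \<sigma> \<alpha> t)"
    by (rule nn_integral_mono) (rule bound)
  also have "\<dots> = ennreal 3 * ?I + (1 + 1)"
    by (simp add: nn_integral_add nn_integral_cmult nn_integral_stopped_lratio P.emeasure_space_1[simplified]
        del: ennreal_numeral)
  finally have *: "ennreal (7/2) \<le> ennreal 3 * ?I + 2" by simp
  show ?thesis
  proof (cases ?I)
    case (real r)
    then have "ennreal (7/2) \<le> ennreal (3 * r + 2)"
      using * by (simp add: ennreal_mult ennreal_plus del: ennreal_plus_if)
    then have "7/2 \<le> 3 * r + 2" using real by (subst (asm) ennreal_le_iff) auto
    then have "ennreal (1/2) \<le> ennreal r" by (intro ennreal_leI) simp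
    then show ?thesis using real by simp
  qed simp
qed

text \<open>On every history the stopped losses for the two signs add up to at least
  \<open>2 * K\<close>, and the two laws overlap in mass at least 1/2, so the two expected losses
  cannot both be small.\<close>

proposition two_point:
  assumes "real T * \<eta>\<^sup>2 / \<sigma>\<^sup>2 \<le> 1/16"
  shows "ennreal (real T * \<eta>\<^sup>2) \<le>
    (\<integral>\<^sup>+h. ennreal (\<Sum>t<T. (\<eta> - fst (h t) \<bullet> g)\<^sup>2) \<partial>traj pol \<sigma> \<alpha> T) +
    (\<integral>\<^sup>+h. ennreal (\<Sum>t<T. (\<eta> + fst (h t) \<bullet> g)\<^sup>2) \<partial>traj pol \<sigma> (\<alpha> - 2 *\<^sub>R g) T)"
proof -
  \<comment> \<open>With this level, \<open>T * \<eta>\<^sup>2 + energy\<close> is at least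
    \<open>K\<close> on every history, and the hypothesis is exactly the smallness of
    \<open>K / \<sigma>\<^sup>2\<close> that the overlap requires.\<close>
  define K where "K = real T * \<eta>\<^sup>2"
  define \<beta> where "\<beta> = \<alpha> - 2 *\<^sub>R g"
  have K: "0 \<le> K" by (simp add: K_def)
  let ?q = "stopped_lratio \<alpha> \<beta> g K T"
  let ?Lp = "stopped_loss \<eta> g K T" and ?Lm = "stopped_loss \<eta> (- g) K T"
  have "ennreal K = ennreal (2 * K) * ennreal (1/2)"
    using K by (subst ennreal_mult[symmetric]) simp_all
  also have "\<dots> \<le> ennreal (2 * K) * (\<integral>\<^sup>+h. ennreal (min 1 (?q h)) \<partial>traj pol \<sigma> \<alpha> T)"
    unfolding \<beta>_def using assms by (intro mult_left_mono stopped_overlap K) (simp_all add: K_def)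
  also have "\<dots> = (\<integral>\<^sup>+h. ennreal (2 * K) * ennreal (min 1 (?q h)) \<partial>traj pol \<sigma> \<alpha> T)"
    by (rule nn_integral_cmult[symmetric]) measurable
  also have "\<dots> \<le> (\<integral>\<^sup>+h. ennreal (?Lp h) + ennreal (?q h) * ennreal (?Lm h) \<partial>traj pol \<sigma> \<alpha> T)"
  proof (rule nn_integral_mono)
    fix h
    have "min K (real T * \<eta>\<^sup>2 + energy g T h) = K"
      using energy_nonneg[of g T h] by (simp add: K_def)
    then have "2 * K \<le> ?Lp h + ?Lm h"
      using stopped_loss_sum_ge[of K T \<eta> g h] by simp
    then have "2 * K * min 1 (?q h) \<le> (?Lp h + ?Lm h) * min 1 (?q h)"
      by (rule mult_right_mono) (simp add: stopped_lratio_nonneg)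
    \<comment> \<open>The weight \<open>min 1 q\<close> is bounded by 1 on the first loss, which
      stays under \<open>\<alpha>\<close>, and by \<open>q\<close> on the second, which moves it to
      \<open>\<beta>\<close>.\<close>
    also have "\<dots> \<le> ?Lp h * 1 + ?Lm h * ?q h"
      unfolding distrib_right
      by (intro add_mono mult_left_mono stopped_loss_nonneg) simp_all
    finally have "ennreal (2 * K * min 1 (?q h)) \<le> ennreal (?Lp h + ?q h * ?Lm h)"
      by (intro ennreal_leI) (simp add: mult.commute)
    then show "ennreal (2 * K) * ennreal (min 1 (?q h)) \<le> ennreal (?Lp h) + ennreal (?q h) * ennreal (?Lm h)"
      using K by (simp add: ennreal_mult ennreal_plus stopped_loss_nonneg stopped_lratio_nonneg
          del: ennreal_plus_if)
  qed
  also have "\<dots> = (\<integral>\<^sup>+h. ennreal (?Lp h) \<partial>traj pol \<sigma> \<alpha> T) + (\<integral>\<^sup>+h. ennreal (?q h) * ennreal (?Lm h) \<partial>traj pol \<sigma> \<alpha> T)"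
    by (rule nn_integral_add) measurable
  also have "\<dots> = (\<integral>\<^sup>+h. ennreal (?Lp h) \<partial>traj pol \<sigma> \<alpha> T) + (\<integral>\<^sup>+h. ennreal (?Lm h) \<partial>traj pol \<sigma> \<beta> T)"
    by (simp add: stopped_loss_change[where g="- g" and \<alpha>=\<alpha> and \<gamma>=\<beta>])
  also have "\<dots> \<le> (\<integral>\<^sup>+h. ennreal (\<Sum>t<T. (\<eta> - fst (h t) \<bullet> g)\<^sup>2) \<partial>traj pol \<sigma> \<alpha> T) +
    (\<integral>\<^sup>+h. ennreal (\<Sum>t<T. (\<eta> + fst (h t) \<bullet> g)\<^sup>2) \<partial>traj pol \<sigma> \<beta> T)"
    unfolding stopped_loss_def by (intro add_mono nn_integral_mono ennreal_leI sum_mono) auto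
  finally show ?thesis by (simp add: K_def \<beta>_def)
qed

end

section \<open>Geometry of the ellipsoid\<close>

definition ip :: "real^'n^'n \<Rightarrow> real^'n \<Rightarrow> real^'n \<Rightarrow> real" where
  "ip A x y = x \<bullet> (A *v y)"

lemma mnorm_ip: "mnorm A u = sqrt (ip A u u)"
  by (simp add: mnorm_def ip_def)

lemma ip_add_left: "ip A (x + y) z = ip A x z + ip A y z"
  and ip_diff_left: "ip A (x - y) z = ip A x z - ip A y z"
  and ip_scaleR_left: "ip A (r *\<^sub>R x) z = r * ip A x z"
  and ip_sum_left: "ip A (sum f I) z = (\<Sum>i\<in>I. ip A (f i) z)"
  by (simp_all add: ip_def inner_add_left inner_diff_left inner_sum_left)

lemma ip_commute: "sym_pos_def A \<Longrightarrow> ip A x y = ip A y x"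
  unfolding ip_def sym_pos_def_def
  by (metis dot_lmul_matrix inner_commute vector_transpose_matrix)

lemma ip_nonneg: "sym_pos_def A \<Longrightarrow> 0 \<le> ip A x x"
  unfolding ip_def sym_pos_def_def by (cases "x = 0") (auto intro: less_imp_le)

lemma ip_pos: "sym_pos_def A \<Longrightarrow> x \<noteq> 0 \<Longrightarrow> 0 < ip A x x"
  by (simp add: ip_def sym_pos_def_def)

lemma sym_pos_def_invertible: "sym_pos_def A \<Longrightarrow> invertible A"
  unfolding invertible_left_inverse matrix_left_invertible_ker sym_pos_def_def
  by (metis inner_zero_right less_irrefl)

lemma matrix_inv_cancel:
  fixes A :: "real^'n^'n"
  assumes "sym_pos_def A"
  shows "A *v (matrix_inv A *v x) = x" "matrix_inv A *v (A *v x) = x"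
proof -
  have "A ** matrix_inv A = mat 1 \<and> matrix_inv A ** A = mat 1"
    using sym_pos_def_invertible[OF assms] unfolding invertible_def matrix_inv_def by (rule someI_ex)
  then show "A *v (matrix_inv A *v x) = x" "matrix_inv A *v (A *v x) = x"
    by (simp_all add: matrix_vector_mul_assoc)
qed

lemma ip_bessel:
  fixes e :: "nat \<Rightarrow> real^'n"
  assumes A: "sym_pos_def A"
    and e: "\<And>i j. i < d \<Longrightarrow> j < d \<Longrightarrow> ip A (e i) (e j) = (if i = j then 1 else 0)"
  shows "(\<Sum>i<d. (ip A u (e i))\<^sup>2) \<le> ip A u u"
proof -
  define v where "v = (\<Sum>i<d. ip A u (e i) *\<^sub>R e i)"
  have ve: "ip A v (e j) = ip A u (e j)" if "j < d" for j
    using that by (simp add: v_def ip_sum_left ip_scaleR_left e if_distrib cong: if_cong)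
  have *: "ip A v z = (\<Sum>i<d. ip A u (e i) * ip A z (e i))" for z
    unfolding v_def by (simp add: ip_sum_left ip_scaleR_left ip_commute[OF A, of _ z])
  have "0 \<le> ip A (u - v) (u - v)" by (rule ip_nonneg[OF A])
  also have "\<dots> = ip A u u - 2 * ip A v u + ip A v v"
    using ip_commute[OF A] by (simp add: ip_diff_left ip_commute[OF A, of _ "u - v"])
  also have "ip A v u = (\<Sum>i<d. (ip A u (e i))\<^sup>2)"
    by (simp add: * power2_eq_square)
  also have "ip A v v = (\<Sum>i<d. (ip A u (e i))\<^sup>2)"
    by (subst *) (simp add: ve power2_eq_square)
  finally show ?thesis by simp
qed

text \<open>Being orthogonal to \<open>y\<close> with respect to \<open>A\<close> is being Euclidean
  orthogonal to \<open>A *v y\<close>. Each new vector thus avoids \<open>k + 2\<close> vectors,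
  namely \<open>A *v \<theta>\<close>, \<open>c\<close> and the \<open>A *v e i\<close>, and the
  first two account for the two extra dimensions.\<close>

lemma ip_orthonormal_exists:
  fixes A :: "real^'n^'n"
  assumes A: "sym_pos_def A" and "k + 2 \<le> CARD('n)"
  shows "\<exists>e. (\<forall>i<k. \<forall>j<k. ip A (e i) (e j) = (if i = j then 1 else 0)) \<and>
             (\<forall>i<k. ip A (e i) \<theta> = 0 \<and> e i \<bullet> c = 0)"
  using assms(2)
proof (induction k)
  case 0
  show ?case by simp
next
  case (Suc k)
  then obtain e where e: "\<And>i j. i < k \<Longrightarrow> j < k \<Longrightarrow> ip A (e i) (e j) = (if i = j then 1 else 0)"
    "\<And>i. i < k \<Longrightarrow> ip A (e i) \<theta> = 0 \<and> e i \<bullet> c = 0" by auto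
  define S where "S = {A *v \<theta>, c} \<union> (\<lambda>i. A *v e i) ` {..<k}"
  have "card S \<le> card {A *v \<theta>, c} + card ((\<lambda>i. A *v e i) ` {..<k})"
    unfolding S_def by (rule card_Un_le)
  also have "\<dots> \<le> 2 + k"
    using card_image_le[of "{..<k}" "\<lambda>i. A *v e i"] by (intro add_mono) (auto simp: card_insert_if)
  finally have "dim S < DIM(real^'n)"
    using dim_le_card'[of S] Suc.prems by (simp add: S_def)
  then obtain x where x: "x \<noteq> 0" "\<And>y. y \<in> span S \<Longrightarrow> orthogonal x y"
    using orthogonal_to_subspace_exists by blast
  then have x': "ip A x \<theta> = 0" "x \<bullet> c = 0" "\<And>i. i < k \<Longrightarrow> ip A x (e i) = 0"
    by (auto simp: S_def span_base orthogonal_def ip_def)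
  define f where "f = (1 / sqrt (ip A x x)) *\<^sub>R x"
  have "ip A f f = (1 / sqrt (ip A x x)) * ((1 / sqrt (ip A x x)) * ip A x x)"
    by (metis f_def ip_scaleR_left ip_commute[OF A])
  then have "ip A f f = 1"
    using ip_pos[OF A x(1)] by (simp add: real_div_sqrt)
  moreover have "ip A f \<theta> = 0" "f \<bullet> c = 0" "\<And>i. i < k \<Longrightarrow> ip A f (e i) = 0" "\<And>i. i < k \<Longrightarrow> ip A (e i) f = 0"
    using x' ip_commute[OF A, of _ f] by (simp_all add: f_def ip_scaleR_left)
  ultimately show ?case
    using e by (intro exI[of _ "e(k := f)"]) (auto simp: less_Suc_eq)
qed

text \<open>The substitution \<open>x = c + A *v w\<close> turns the ellipsoid into the unit ball of
  \<open>ip A\<close>.\<close>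

lemma ellipsoid_coordinates:
  assumes A: "sym_pos_def A" and x: "x \<in> ellipsoid A c"
  obtains w where "ip A w w \<le> 1" "\<And>y. x \<bullet> y = c \<bullet> y + ip A w y"
proof
  let ?w = "matrix_inv A *v (x - c)"
  have Aw: "A *v ?w = x - c" by (rule matrix_inv_cancel[OF A])
  show "ip A ?w ?w \<le> 1"
    using x by (simp add: ellipsoid_def mnorm_def ip_def Aw inner_commute)
  show "x \<bullet> y = c \<bullet> y + ip A ?w y" for y
    unfolding ip_commute[OF A, of ?w] unfolding ip_def Aw by (simp add: inner_diff_right inner_commute)
qed

text \<open>In these coordinates \<open>\<theta> / B\<close> is a unit vector and \<open>w\<close>
  lies in the unit ball, so the gap is at least \<open>B / 2\<close> times the squared
  \<open>A\<close>-norm of \<open>\<theta> / B - w\<close>. Bessel's inequality passes to the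
  coordinates along \<open>e i\<close>, where the offset \<open>c\<close> is invisible.\<close>

lemma ellipsoid_gap:
  fixes e :: "nat \<Rightarrow> real^'n"
  assumes A: "sym_pos_def A" and x: "x \<in> ellipsoid A c" and B: "B > 0" "ip A \<theta> \<theta> = B\<^sup>2"
    and e: "\<And>i j. i < d \<Longrightarrow> j < d \<Longrightarrow> ip A (e i) (e j) = (if i = j then 1 else 0)"
    and c: "\<And>i. i < d \<Longrightarrow> e i \<bullet> c = 0"
  shows "B / 2 * (\<Sum>i<d. (ip A \<theta> (e i) / B - x \<bullet> e i)\<^sup>2) \<le> c \<bullet> \<theta> + B - x \<bullet> \<theta>"
proof -
  obtain w where w: "ip A w w \<le> 1" "\<And>y. x \<bullet> y = c \<bullet> y + ip A w y"
    using ellipsoid_coordinates[OF A x] by blast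
  define u where "u = (1 / B) *\<^sub>R \<theta> - w"
  have "ip A \<theta> (e i) / B - x \<bullet> e i = ip A u (e i)" if "i < d" for i
    using c[OF that] by (simp add: u_def w(2) ip_diff_left ip_scaleR_left inner_commute)
  then have "(\<Sum>i<d. (ip A \<theta> (e i) / B - x \<bullet> e i)\<^sup>2) \<le> ip A u u"
    using ip_bessel[OF A e, of d u] by simp
  also have "ip A u u = 1 - 2 * ip A w \<theta> / B + ip A w w"
    using B ip_commute[OF A, of \<theta> u] ip_commute[OF A, of w u] ip_commute[OF A, of \<theta> w]
    by (simp add: u_def ip_diff_left ip_scaleR_left power2_eq_square field_simps)
  also have "\<dots> \<le> 2 - 2 * ip A w \<theta> / B" using w(1) by simp
  finally have "B / 2 * (\<Sum>i<d. (ip A \<theta> (e i) / B - x \<bullet> e i)\<^sup>2) \<le> B / 2 * (2 - 2 * ip A w \<theta> / B)"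
    using B by (intro mult_left_mono) auto
  also have "\<dots> = c \<bullet> \<theta> + B - x \<bullet> \<theta>"
    using B w(2)[of \<theta>] by (simp add: field_simps)
  finally show ?thesis .
qed

text \<open>With \<open>d = 0\<close> the sum in \<open>ellipsoid_gap\<close> is empty, leaving
  nonnegativity. The gaps for \<open>\<theta>\<close> and \<open>- \<theta>\<close> add up to
  \<open>2 * B\<close>, which gives the upper bound.\<close>

lemma ellipsoid_gap_bounds:
  assumes A: "sym_pos_def A" and x: "x \<in> ellipsoid A c" and B: "B > 0" "ip A \<theta> \<theta> = B\<^sup>2"
  shows "0 \<le> c \<bullet> \<theta> + B - x \<bullet> \<theta>" "c \<bullet> \<theta> + B - x \<bullet> \<theta> \<le> 2 * B"
proof -
  show "0 \<le> c \<bullet> \<theta> + B - x \<bullet> \<theta>"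
    using ellipsoid_gap[OF A x B, where d=0 and e="\<lambda>_. 0"] by simp
  have "ip A (- \<theta>) (- \<theta>) = B\<^sup>2"
    using B(2) ip_scaleR_left[of A "-1" \<theta> "- \<theta>"] ip_commute[OF A, of \<theta> "- \<theta>"]
      ip_scaleR_left[of A "-1" \<theta> \<theta>] by simp
  then show "c \<bullet> \<theta> + B - x \<bullet> \<theta> \<le> 2 * B"
    using ellipsoid_gap[OF A x B(1), where \<theta>="- \<theta>" and d=0 and e="\<lambda>_. 0"] by simp
qed

lemma ellipsoid_support:
  assumes A: "sym_pos_def A" and B: "B > 0" "ip A \<theta> \<theta> = B\<^sup>2"
  shows "(SUP x\<in>ellipsoid A c. x \<bullet> \<theta>) = c \<bullet> \<theta> + B"
proof (rule cSup_eq_maximum)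
  let ?x = "c + (1 / B) *\<^sub>R (A *v \<theta>)"
  have "?x - c = A *v ((1 / B) *\<^sub>R \<theta>)" by (simp add: matrix_vector_mult_scaleR)
  then have "matrix_inv A *v (?x - c) = (1 / B) *\<^sub>R \<theta>"
    by (metis matrix_inv_cancel(2)[OF A])
  moreover have \<theta>: "(A *v \<theta>) \<bullet> \<theta> = B\<^sup>2" using B(2) by (simp add: ip_def inner_commute)
  ultimately have "?x \<in> ellipsoid A c"
    using B(1) by (simp add: ellipsoid_def mnorm_def power2_eq_square)
  moreover have "?x \<bullet> \<theta> = c \<bullet> \<theta> + B"
    using B(1) \<theta> by (simp add: inner_add_left power2_eq_square)
  ultimately show "c \<bullet> \<theta> + B \<in> (\<lambda>x. x \<bullet> \<theta>) ` ellipsoid A c"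
    by (metis imageI)
next
  fix y assume "y \<in> (\<lambda>x. x \<bullet> \<theta>) ` ellipsoid A c"
  then show "y \<le> c \<bullet> \<theta> + B"
    using ellipsoid_gap_bounds(1)[OF A _ B] by fastforce
qed

lemma ellipsoid_borel: "ellipsoid A c \<in> sets borel"
proof -
  have "ellipsoid A c = {x. sqrt ((x - c) \<bullet> (matrix_inv A *v (x - c))) \<le> 1}"
    by (simp add: ellipsoid_def mnorm_def)
  also have "closed \<dots>"
    by (intro closed_Collect_le continuous_intros
        bounded_linear.continuous_on[OF matrix_vector_mul_bounded_linear])
  finally show ?thesis by (rule borel_closed)
qed

text \<open>For each \<open>i\<close>, the subsets of \<open>{..<d}\<close> split into
  \<open>2 ^ (d - 1)\<close> pairs that differ in \<open>i\<close> alone. Summing over pairs and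
  \<open>i\<close> bounds the average over all vertices from below, so some vertex attains
  it.\<close>

lemma cube_average:
  fixes f :: "nat \<Rightarrow> nat set \<Rightarrow> real"
  assumes "\<And>i J. i < d \<Longrightarrow> J \<subseteq> {..<d} - {i} \<Longrightarrow> b \<le> f i (insert i J) + f i J"
  shows "\<exists>J\<subseteq>{..<d}. real d * b / 2 \<le> (\<Sum>i<d. f i J)"
proof (rule ccontr)
  assume "\<not> ?thesis"
  then have "(\<Sum>J\<in>Pow {..<d}. \<Sum>i<d. f i J) < (\<Sum>J\<in>Pow {..<d}. real d * b / 2)"
    by (intro sum_strict_mono) auto
  also have "\<dots> = 2 ^ d * (real d * b / 2)" by (simp add: card_Pow)
  also have "\<dots> = (\<Sum>i<d. 2 ^ (d - 1) * b)" by (cases d) simp_all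
  also have "\<dots> \<le> (\<Sum>i<d. \<Sum>J\<in>Pow {..<d}. f i J)"
  proof (rule sum_mono)
    fix i assume "i \<in> {..<d}"
    then have i: "i < d" by simp
    let ?P = "Pow ({..<d} - {i})"
    have "{..<d} = insert i ({..<d} - {i})" using i by auto
    then have P: "Pow {..<d} = ?P \<union> insert i ` ?P"
      by (metis Pow_insert)
    have "2 ^ (d - 1) * b = (\<Sum>J\<in>?P. b)" using i by (simp add: card_Pow)
    also have "\<dots> \<le> (\<Sum>J\<in>?P. f i (insert i J) + f i J)"
      using assms[OF i] by (intro sum_mono) auto
    also have "\<dots> = (\<Sum>J\<in>insert i ` ?P. f i J) + (\<Sum>J\<in>?P. f i J)"
      by (subst sum.reindex) (auto simp: inj_on_def sum.distrib insert_ident)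
    also have "\<dots> = (\<Sum>J\<in>Pow {..<d}. f i J)"
      unfolding P by (subst sum.union_disjoint) (auto simp: add.commute)
    finally show "2 ^ (d - 1) * b \<le> (\<Sum>J\<in>Pow {..<d}. f i J)" .
  qed
  also have "\<dots> = (\<Sum>J\<in>Pow {..<d}. \<Sum>i<d. f i J)" by (rule sum.swap)
  finally show False by simp
qed

section \<open>The lower bound\<close>

context bandit
begin

text \<open>Taking \<open>g = \<delta> *\<^sub>R e\<close> and
  \<open>\<eta> = \<zeta> * \<delta>\<close> in \<open>two_point\<close> multiplies both sides by
  \<open>\<delta>\<^sup>2\<close>. This separates the parameter shift \<open>\<delta>\<close> from
  the target \<open>\<zeta>\<close> for the coordinate of the action.\<close>

corollary two_point_scaled:
  assumes "\<delta> > 0" "real T * \<zeta>\<^sup>2 * \<delta>\<^sup>2 / \<sigma>\<^sup>2 \<le> 1/16"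
  shows "ennreal (real T * \<zeta>\<^sup>2) \<le>
    (\<integral>\<^sup>+h. ennreal (\<Sum>t<T. (\<zeta> - fst (h t) \<bullet> e)\<^sup>2) \<partial>traj pol \<sigma> \<alpha> T) +
    (\<integral>\<^sup>+h. ennreal (\<Sum>t<T. (\<zeta> + fst (h t) \<bullet> e)\<^sup>2) \<partial>traj pol \<sigma> (\<alpha> - (2 * \<delta>) *\<^sub>R e) T)"
    (is "_ \<le> ?I + ?J")
proof -
  have meas: "(\<lambda>h. \<Sum>t<T. (\<zeta> + s * (fst (h t) \<bullet> e))\<^sup>2) \<in> borel_measurable (hist_space T)" for s
    by (intro borel_measurable_sum borel_measurable_power borel_measurable_inner borel_measurable_add
        borel_measurable_times hist_fst_measurable borel_measurable_const) simp
  have scale: "ennreal (\<Sum>t<T. (\<zeta> * \<delta> + s * (fst (h t) \<bullet> (\<delta> *\<^sub>R e)))\<^sup>2) =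
      ennreal (\<delta>\<^sup>2) * ennreal (\<Sum>t<T. (\<zeta> + s * (fst (h t) \<bullet> e))\<^sup>2)"
    for s and h :: "nat \<Rightarrow> (real^'n) \<times> real"
  proof -
    have "(\<zeta> * \<delta> + s * (fst (h t) \<bullet> (\<delta> *\<^sub>R e)))\<^sup>2 = \<delta>\<^sup>2 * (\<zeta> + s * (fst (h t) \<bullet> e))\<^sup>2" for t
      by (simp add: power2_eq_square algebra_simps)
    then show ?thesis
      by (simp add: ennreal_mult[symmetric] sum_nonneg sum_distrib_left)
  qed
  have "ennreal (\<delta>\<^sup>2) * ennreal (real T * \<zeta>\<^sup>2) = ennreal (real T * (\<zeta> * \<delta>)\<^sup>2)"
    by (simp add: ennreal_mult[symmetric] power_mult_distrib mult_ac)
  also have "\<dots> \<le> ennreal (\<delta>\<^sup>2) * (?I + ?J)"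
    using two_point[where T=T and \<eta>="\<zeta> * \<delta>" and g="\<delta> *\<^sub>R e" and \<alpha>=\<alpha>] assms(2) scale[of "-1"] scale[of 1] meas[of "-1"] meas[of 1]
    by (simp add: power_mult_distrib mult.assoc nn_integral_cmult distrib_left)
  finally show ?thesis
    using assms(1) by (simp add: ennreal_mult_le_mult_iff)
qed

text \<open>The expected number of actions outside \<open>E\<close> is 0: each round adds to it only
  the policy's mass on the complement.\<close>

lemma AE_traj_action:
  assumes E: "E \<in> sets borel" and supp: "\<And>t h. h \<in> space (hist_space t) \<Longrightarrow> emeasure (pol t h) E = 1"
  shows "AE h in traj pol \<sigma> \<theta> T. \<forall>t<T. fst (h t) \<in> E"
proof -
  define f where "f t h = (\<Sum>s<t. indicator (- E) (fst (h s)) :: ennreal)"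
    for t and h :: "nat \<Rightarrow> (real^'n) \<times> real"
  have nE [measurable]: "- E \<in> sets borel" using E by simp
  have f_meas [measurable]: "f t \<in> borel_measurable (hist_space t)" for t
    unfolding f_def[abs_def]
    by (intro borel_measurable_sum measurable_compose[OF hist_fst_measurable borel_measurable_indicator[OF nE]])
      simp
  have "(\<integral>\<^sup>+h. f t h \<partial>traj pol \<sigma> \<theta> t) = 0" for t
  proof (induction t)
    case 0
    show ?case by (simp add: f_def)
  next
    case (Suc t)
    have "(\<integral>\<^sup>+k. f (Suc t) k \<partial>play_round \<theta> t h) = f t h" if h: "h \<in> space (hist_space t)" for h
    proof -
      interpret P: prob_space "pol t h" by (rule prob_space_policy[OF h])
      have sp [measurable_cong]: "sets (pol t h) = sets borel"
        using measurable_space[OF policy h] by (simp add: space_prob_algebra)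
      have UNIV: "emeasure (pol t h) UNIV = 1"
        using P.emeasure_space_1 sets_eq_imp_space_eq[OF sp] by simp
      have "emeasure (pol t h) (UNIV - E) = emeasure (pol t h) UNIV - emeasure (pol t h) E"
        using E sp by (intro emeasure_Diff) (auto simp: supp[OF h])
      then have "emeasure (pol t h) (- E) = 0"
        by (simp add: UNIV supp[OF h] Compl_eq_Diff_UNIV)
      moreover have "(\<integral>\<^sup>+k. f (Suc t) k \<partial>play_round \<theta> t h) = (\<integral>\<^sup>+x. f t h + indicator (- E) x \<partial>pol t h)"
        by (rule nn_integral_play_round_action[OF h f_meas]) (simp add: f_def)
      ultimately show ?thesis
        using sp by (simp add: nn_integral_add P.emeasure_space_1)
    qed
    then show ?case
      using Suc by (simp add: nn_integral_traj_Suc cong: nn_integral_cong_simp)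
  qed
  from this[of T] have "AE h in traj pol \<sigma> \<theta> T. f T h = 0"
    by (subst (asm) nn_integral_0_iff_AE) (simp_all cong: measurable_cong_sets)
  then show ?thesis
    by (rule AE_mp) (auto simp: f_def indicator_def split: if_splits)
qed

text \<open>The gap inequality, summed over the rounds and integrated; it holds almost surely,
  because the actions lie in the ellipsoid almost surely.\<close>

lemma ellipsoid_regret_lower:
  fixes e :: "nat \<Rightarrow> real^'n"
  assumes A: "sym_pos_def A" and alg: "is_algorithm (ellipsoid A c) pol"
    and B: "B > 0" "ip A \<theta> \<theta> = B\<^sup>2"
    and e: "\<And>i j. i < d \<Longrightarrow> j < d \<Longrightarrow> ip A (e i) (e j) = (if i = j then 1 else 0)"
    and c: "\<And>i. i < d \<Longrightarrow> e i \<bullet> c = 0"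
  shows "(\<Sum>i<d. \<integral>\<^sup>+h. ennreal (\<Sum>t<T. (ip A \<theta> (e i) / B - fst (h t) \<bullet> e i)\<^sup>2) \<partial>traj pol \<sigma> \<theta> T)
    \<le> ennreal (2 / B * regret (ellipsoid A c) pol \<sigma> \<theta> T)"
proof -
  let ?E = "ellipsoid A c"
  let ?M = "traj pol \<sigma> \<theta> T"
  interpret P: prob_space ?M by (rule prob_space_traj)
  define R where "R h = (\<Sum>t<T. c \<bullet> \<theta> + B - fst (h t) \<bullet> \<theta>)" for h :: "nat \<Rightarrow> (real^'n) \<times> real"
  define V where "V i h = (\<Sum>t<T. (ip A \<theta> (e i) / B - fst (h t) \<bullet> e i)\<^sup>2)"
    for i and h :: "nat \<Rightarrow> (real^'n) \<times> real"
  have regret: "regret ?E pol \<sigma> \<theta> T = (\<integral>h. R h \<partial>?M)"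
    unfolding regret_def ellipsoid_support[OF A B] R_def ..
  have R_meas: "R \<in> borel_measurable ?M"
    unfolding R_def[abs_def] measurable_cong_sets[OF sets_traj refl]
    by (intro borel_measurable_sum borel_measurable_diff borel_measurable_inner
        hist_fst_measurable borel_measurable_const) simp
  have V_meas: "V i \<in> borel_measurable ?M" for i
    unfolding V_def[abs_def] measurable_cong_sets[OF sets_traj refl]
    by (intro borel_measurable_sum borel_measurable_diff borel_measurable_inner borel_measurable_power
        hist_fst_measurable borel_measurable_const) simp
  have AE: "AE h in ?M. \<forall>t<T. fst (h t) \<in> ?E"
    by (rule AE_traj_action[OF ellipsoid_borel]) (use alg in \<open>simp add: is_algorithm_def\<close>)
  have R_bounds: "0 \<le> R h" "R h \<le> real T * (2 * B)" if "\<forall>t<T. fst (h t) \<in> ?E"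
    for h :: "nat \<Rightarrow> (real^'n) \<times> real"
    using that ellipsoid_gap_bounds[OF A _ B] sum_bounded_above[of "{..<T}" "\<lambda>t. c \<bullet> \<theta> + B - fst (h t) \<bullet> \<theta>" "2 * B"]
    by (auto simp: R_def intro!: sum_nonneg)
  \<comment> \<open>Almost sure boundedness ensures that the Bochner integral defining the regret is
    a genuine expectation and not the default value 0.\<close>
  have R_int: "integrable ?M R"
    using AE by (intro P.integrable_const_bound[where B="real T * (2 * B)"] R_meas)
      (auto elim!: AE_mp simp: R_bounds)
  have VR: "(\<Sum>i<d. V i h) \<le> 2 / B * R h" if "\<forall>t<T. fst (h t) \<in> ?E"
    for h :: "nat \<Rightarrow> (real^'n) \<times> real"
  proof -
    have "(\<Sum>i<d. V i h) = (\<Sum>t<T. \<Sum>i<d. (ip A \<theta> (e i) / B - fst (h t) \<bullet> e i)\<^sup>2)"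
      unfolding V_def by (rule sum.swap)
    also have "\<dots> \<le> (\<Sum>t<T. 2 / B * (c \<bullet> \<theta> + B - fst (h t) \<bullet> \<theta>))"
    proof (rule sum_mono)
      fix t assume "t \<in> {..<T}"
      then have "B / 2 * (\<Sum>i<d. (ip A \<theta> (e i) / B - fst (h t) \<bullet> e i)\<^sup>2) \<le> c \<bullet> \<theta> + B - fst (h t) \<bullet> \<theta>"
        using that by (intro ellipsoid_gap[OF A _ B e c]) auto
      then have "2 / B * (B / 2 * (\<Sum>i<d. (ip A \<theta> (e i) / B - fst (h t) \<bullet> e i)\<^sup>2)) \<le>
          2 / B * (c \<bullet> \<theta> + B - fst (h t) \<bullet> \<theta>)"
        using B(1) by (intro mult_left_mono) auto
      then show "(\<Sum>i<d. (ip A \<theta> (e i) / B - fst (h t) \<bullet> e i)\<^sup>2) \<le>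
          2 / B * (c \<bullet> \<theta> + B - fst (h t) \<bullet> \<theta>)"
        using B(1) by simp
    qed
    also have "\<dots> = 2 / B * R h" by (simp add: R_def sum_distrib_left)
    finally show ?thesis .
  qed
  have "(\<Sum>i<d. \<integral>\<^sup>+h. ennreal (V i h) \<partial>?M) = (\<integral>\<^sup>+h. (\<Sum>i<d. ennreal (V i h)) \<partial>?M)"
    using V_meas by (intro nn_integral_sum[symmetric]) simp
  also have "\<dots> \<le> (\<integral>\<^sup>+h. ennreal (2 / B * R h) \<partial>?M)"
  proof (rule nn_integral_mono_AE, use AE in \<open>rule AE_mp\<close>, intro AE_I2 impI)
    fix h :: "nat \<Rightarrow> (real^'n) \<times> real"
    assume "\<forall>t<T. fst (h t) \<in> ?E"
    from VR[OF this] show "(\<Sum>i<d. ennreal (V i h)) \<le> ennreal (2 / B * R h)"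
      by (subst sum_ennreal) (auto simp: V_def sum_nonneg ennreal_leI)
  qed
  also have "\<dots> = ennreal (\<integral>h. 2 / B * R h \<partial>?M)"
    using AE B(1) by (intro nn_integral_eq_integral integrable_mult_right R_int)
      (auto elim!: AE_mp simp: R_bounds)
  finally show ?thesis
    by (simp add: V_def regret)
qed

end

theorem theorem1:
  fixes A :: "real^'n^'n" and c :: "real^'n" and \<sigma> :: real
    and pol :: "nat \<Rightarrow> (nat \<Rightarrow> (real^'n) \<times> real) \<Rightarrow> (real^'n) measure"
    and B :: real and T :: nat and \<theta> :: "real^'n"
  assumes dim: "CARD('n) \<ge> 3"
    and A: "sym_pos_def A"
    and sigma: "\<sigma> > 0"
    and alg: "is_algorithm (ellipsoid A c) pol"
    and B: "B > 0"
    and T: "T \<ge> 1"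
    and theta: "mnorm A \<theta> = B"
  shows "\<exists>\<theta>'. mnorm A \<theta>' = B \<and>
     (mnorm A (\<theta> - \<theta>'))\<^sup>2 \<le> min (\<sigma> * real (CARD('n) - 2) * B / sqrt (real T)) (4 * B\<^sup>2) \<and>
     regret (ellipsoid A c) pol \<sigma> \<theta>' T
       \<ge> min (\<sigma> * real (CARD('n) - 2) * sqrt (real T) / 16) (B * real T / 4)"
proof -
  interpret bandit pol \<sigma>
    using sigma alg by unfold_locales (auto simp: is_algorithm_def)
  define d where "d = CARD('n) - 2"
  have d: "d \<ge> 1" "d + 2 \<le> CARD('n)" using dim by (auto simp: d_def)
  \<comment> \<open>The allowed squared distance divided by \<open>B\<^sup>2\<close>; both bounds of
    the claim are multiples of it.\<close>
  define r where "r = min (\<sigma> * real d / (B * sqrt (real T))) 4"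
  have T0: "sqrt (real T) > 0" "(sqrt (real T))\<^sup>2 = real T" using T by simp_all
  have r: "0 < r" "r \<le> 4" "r \<le> \<sigma> * real d / (B * sqrt (real T))"
    using sigma B d T0 by (auto simp: r_def)
  have rB: "r * B\<^sup>2 = min (\<sigma> * real d * B / sqrt (real T)) (4 * B\<^sup>2)"
    using B T0 by (simp add: r_def min_mult_distrib_right power2_eq_square)
  have rT: "B * real T * r / 16 = min (\<sigma> * real d * sqrt (real T) / 16) (B * real T / 4)"
  proof -
    have "B * real T * (\<sigma> * real d / (B * sqrt (real T))) = \<sigma> * real d * sqrt (real T)"
      using B T0 by (simp add: field_simps power2_eq_square)
    moreover have "B * real T * r = min (B * real T * (\<sigma> * real d / (B * sqrt (real T)))) (B * real T * 4)"
      using B by (simp only: r_def min_mult_distrib_left) simp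
    ultimately show ?thesis by (simp add: min_def)
  qed
  \<comment> \<open>Chosen so that \<open>d * \<delta>\<^sup>2 = r / 4 * B\<^sup>2\<close>, the
    squared norm that shrinking \<open>\<theta>\<close> by \<open>w\<close> below takes
    away.\<close>
  define \<delta> where "\<delta> = sqrt (B\<^sup>2 * r / (4 * real d))"
  have \<delta>: "\<delta> > 0" "\<delta>\<^sup>2 = B\<^sup>2 * r / (4 * real d)"
    using B r d by (simp_all add: \<delta>_def)
  \<comment> \<open>The best action for a vertex has coordinate \<open>\<zeta>\<close> or
    \<open>- \<zeta>\<close> along each \<open>e i\<close>.\<close>
  define \<zeta> where "\<zeta> = \<delta> / B"
  \<comment> \<open>The first term of the minimum in \<open>r\<close> gives
    \<open>\<delta>\<^sup>2 \<le> B * \<sigma> / (4 * sqrt T)\<close>; squaring yields 1/16.\<close>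
  have cond: "real T * \<zeta>\<^sup>2 * \<delta>\<^sup>2 / \<sigma>\<^sup>2 \<le> 1/16"
  proof -
    have "B\<^sup>2 * r / (4 * real d) \<le> B\<^sup>2 * (\<sigma> * real d / (B * sqrt (real T))) / (4 * real d)"
      using r(3) d by (intro divide_right_mono mult_left_mono) auto
    also have "\<dots> = B * \<sigma> / (4 * sqrt (real T))"
      using B T0 d by (simp add: field_simps power2_eq_square)
    finally have "\<delta>\<^sup>2 \<le> B * \<sigma> / (4 * sqrt (real T))"
      unfolding \<delta>(2) .
    then have "(\<delta>\<^sup>2)\<^sup>2 \<le> (B * \<sigma> / (4 * sqrt (real T)))\<^sup>2"
      by (rule power_mono) simp
    then have "(\<delta>\<^sup>2)\<^sup>2 \<le> B\<^sup>2 * \<sigma>\<^sup>2 / (16 * real T)"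
      by (simp add: power_divide power_mult_distrib)
    then show ?thesis
      using B T sigma by (simp add: \<zeta>_def field_simps power2_eq_square)
  qed
  obtain e where e: "\<And>i j. i < d \<Longrightarrow> j < d \<Longrightarrow> ip A (e i) (e j) = (if i = j then 1 else 0)"
    and e\<theta>: "\<And>i. i < d \<Longrightarrow> ip A (e i) \<theta> = 0" and ec: "\<And>i. i < d \<Longrightarrow> e i \<bullet> c = 0"
    using ip_orthonormal_exists[OF A d(2), of \<theta> c] by metis
  have \<theta>: "ip A \<theta> \<theta> = B\<^sup>2"
    using theta ip_nonneg[OF A, of \<theta>] by (auto simp: mnorm_ip)
  \<comment> \<open>The root is real because \<open>r \<le> 4\<close>; this is what the second term
    of the minimum is for.\<close>
  define w where "w = sqrt (1 - r / 4)"
  have w: "0 \<le> w" "w\<^sup>2 = 1 - r / 4" "1 - r / 4 \<le> w"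
  proof -
    show "0 \<le> w" "w\<^sup>2 = 1 - r / 4" using r by (simp_all add: w_def)
    moreover from this have "w \<le> 1" using r by (simp add: w_def)
    ultimately show "1 - r / 4 \<le> w"
      using mult_left_mono[of w 1 w] by (simp add: power2_eq_square)
  qed
  define \<epsilon> where "\<epsilon> J i = (if i \<in> J then \<delta> else - \<delta>)" for J and i :: nat
  define \<Theta> where "\<Theta> J = w *\<^sub>R \<theta> + (\<Sum>i<d. \<epsilon> J i *\<^sub>R e i)" for J
  have \<Theta>e: "ip A (\<Theta> J) (e i) = \<epsilon> J i" if "i < d" for i J
    using that e\<theta>[OF that] ip_commute[OF A, of \<theta> "e i"]
    by (simp add: \<Theta>_def ip_add_left ip_sum_left ip_scaleR_left e if_distrib[of "(*) _"] cong: if_cong)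
  have \<Theta>\<theta>: "ip A (\<Theta> J) \<theta> = w * B\<^sup>2" for J
    by (simp add: \<Theta>_def ip_add_left ip_sum_left ip_scaleR_left e\<theta> \<theta>)
  have \<Theta>\<Theta>: "ip A (\<Theta> J) (\<Theta> J) = B\<^sup>2" for J
  proof -
    have "ip A (\<Theta> J) (\<Theta> J) = w * ip A \<theta> (\<Theta> J) + (\<Sum>i<d. \<epsilon> J i * ip A (e i) (\<Theta> J))"
      by (subst (1) \<Theta>_def) (simp add: ip_add_left ip_sum_left ip_scaleR_left)
    also have "\<dots> = w\<^sup>2 * B\<^sup>2 + (\<Sum>i<d. \<delta>\<^sup>2)"
      using ip_commute[OF A, of _ "\<Theta> J"]
      by (intro arg_cong2[where f="(+)"] sum.cong) (auto simp: \<Theta>\<theta> \<Theta>e \<epsilon>_def power2_eq_square)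
    also have "\<dots> = B\<^sup>2" using d by (simp add: w \<delta>(2) field_simps)
    finally show ?thesis .
  qed
  \<comment> \<open>The squared distance is \<open>2 * B\<^sup>2 * (1 - w)\<close>, hence at most
    half of what is allowed.\<close>
  have dist: "(mnorm A (\<theta> - \<Theta> J))\<^sup>2 \<le> r * B\<^sup>2" for J
  proof -
    have "(mnorm A (\<theta> - \<Theta> J))\<^sup>2 = ip A (\<theta> - \<Theta> J) (\<theta> - \<Theta> J)"
      by (simp add: mnorm_ip ip_nonneg[OF A])
    also have "\<dots> = 2 * B\<^sup>2 * (1 - w)"
      using ip_commute[OF A, of \<theta> "\<theta> - \<Theta> J"] ip_commute[OF A, of "\<Theta> J" "\<theta> - \<Theta> J"] ip_commute[OF A, of \<theta> "\<Theta> J"]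
      by (simp add: ip_diff_left \<Theta>\<theta> \<Theta>\<Theta> \<theta> algebra_simps)
    also have "\<dots> \<le> 2 * B\<^sup>2 * (r / 4)"
      using w(3) by (intro mult_left_mono) auto
    also have "\<dots> \<le> r * B\<^sup>2" using r(1) by simp
    finally show ?thesis .
  qed
  define F where "F i J = (\<integral>\<^sup>+h. ennreal (\<Sum>t<T. (ip A (\<Theta> J) (e i) / B - fst (h t) \<bullet> e i)\<^sup>2) \<partial>traj pol \<sigma> (\<Theta> J) T)"
    for i J
  have F_sum: "(\<Sum>i<d. F i J) \<le> ennreal (2 / B * regret (ellipsoid A c) pol \<sigma> (\<Theta> J) T)" for J
    unfolding F_def by (rule ellipsoid_regret_lower[OF A alg B \<Theta>\<Theta> e ec])
  \<comment> \<open>Each \<open>F i J\<close> is dominated by a real regret, so the averaging can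
    take place in the reals.\<close>
  have F_fin: "F i J < \<top>" if "i < d" for i J
  proof -
    have "F i J \<le> (\<Sum>i<d. F i J)" using that by (intro member_le_sum) auto
    also note F_sum
    finally show ?thesis by (rule le_less_trans) simp
  qed
  have pair: "real T * \<zeta>\<^sup>2 \<le> enn2real (F i (insert i J)) + enn2real (F i J)"
    if i: "i < d" and J: "J \<subseteq> {..<d} - {i}" for i J
  proof -
    have "(\<Sum>j<d. \<epsilon> (insert i J) j *\<^sub>R e j) - (\<Sum>j<d. \<epsilon> J j *\<^sub>R e j) =
        (\<Sum>j<d. if j = i then (2 * \<delta>) *\<^sub>R e i else 0)"
      unfolding sum_subtractf[symmetric] using J
      by (intro sum.cong) (auto simp: \<epsilon>_def scaleR_left_distrib[symmetric])
    then have flip: "\<Theta> J = \<Theta> (insert i J) - (2 * \<delta>) *\<^sub>R e i"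
      using i by (simp add: \<Theta>_def algebra_simps)
    have "i \<notin> J" using J by auto
    have neg: "(- \<zeta> - x)\<^sup>2 = (\<zeta> + x)\<^sup>2" for x by (simp add: power2_eq_square algebra_simps)
    have "ennreal (real T * \<zeta>\<^sup>2) \<le> F i (insert i J) + F i J"
      using two_point_scaled[OF \<delta>(1) cond, where e="e i" and \<alpha>="\<Theta> (insert i J)"] \<open>i \<notin> J\<close>
      unfolding flip[symmetric] F_def by (simp add: \<Theta>e[OF i] \<epsilon>_def \<zeta>_def[symmetric] neg)
    also have "\<dots> = ennreal (enn2real (F i (insert i J)) + enn2real (F i J))"
      using F_fin[OF i] by (simp add: ennreal_plus)
    finally show ?thesis by (subst (asm) ennreal_le_iff) simp_all
  qed
  obtain J where J: "real d * (real T * \<zeta>\<^sup>2) / 2 \<le> (\<Sum>i<d. enn2real (F i J))"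
    using cube_average[of d "real T * \<zeta>\<^sup>2" "\<lambda>i J. enn2real (F i J)"] pair by blast
  \<comment> \<open>Since \<open>ennreal\<close> sends negative reals to 0, positivity of the left
    side is what brings the inequality back to the reals.\<close>
  have pos: "0 < real d * (real T * \<zeta>\<^sup>2) / 2"
    using d T \<delta> B by (simp add: \<zeta>_def)
  have "ennreal (\<Sum>i<d. enn2real (F i J)) = (\<Sum>i<d. F i J)"
    using F_fin by (subst sum_ennreal[symmetric]) auto
  then have "ennreal (real d * (real T * \<zeta>\<^sup>2) / 2) \<le> ennreal (2 / B * regret (ellipsoid A c) pol \<sigma> (\<Theta> J) T)"
    using J F_sum[of J] by (metis ennreal_leI order_trans)
  then have "real d * (real T * \<zeta>\<^sup>2) / 2 \<le> 2 / B * regret (ellipsoid A c) pol \<sigma> (\<Theta> J) T"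
    using pos by (simp add: ennreal_le_iff2)
  then have "B * real T * (real d * \<zeta>\<^sup>2) / 4 \<le> regret (ellipsoid A c) pol \<sigma> (\<Theta> J) T"
    using B by (simp add: field_simps)
  moreover have "real d * \<zeta>\<^sup>2 = r / 4"
    using B d by (simp add: \<zeta>_def \<delta>(2) power_divide)
  ultimately have "B * real T * r / 16 \<le> regret (ellipsoid A c) pol \<sigma> (\<Theta> J) T" by simp
  moreover have "mnorm A (\<Theta> J) = B" using \<Theta>\<Theta> B by (simp add: mnorm_ip)
  ultimately show ?thesis
    using dist[of J] unfolding rB rT unfolding d_def by blast
qed

end
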